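(* Let $m\in\mathbb N$, let $\varphi\in L^2(\mathbb R^m,d\gamma)$, and let $f(x,t)=e^{itL}\varphi(x)$ for $x\in\mathbb R^m$, $t\in\mathbb R$. Let $s\in\mathbb R$ and assume that for some $a,b>0$ one has $$\big\|e^{a|\cdot|^2}f(\cdot,0)\big\|_{L^2(\mathbb R^m,d\gamma)}+\big\|e^{b|\cdot|^2}f(\cdot,s)\big\|_{L^2(\mathbb R^m,d\gamma)}<\infty .$$ If $ab\,\sin^2 s\ge \frac1{16}$, then $f\equiv 0$ in $\mathbb R^m\times\mathbb R$.
   Context: $d\gamma(x)=e^{-|x|^2/2}\,dx$ on $\mathbb R^m$ (not normalized). $L$ is the Ornstein-Uhlenbeck operator $L\varphi=\Delta\varphi-\langle x,\nabla\varphi\rangle$, which is symmetric on $C_0^\infty(\mathbb R^m)$ with respect to $d\gamma$ and is regarded as a self-adjoint operator in $L^2(\mathbb R^m,d\gamma)$ (complex-valued functions). $e^{itL}$, $t\in\mathbb R$, is the strongly continuous group of unitary operators in $L^2(\mathbb R^m,d\gamma)$ generated by $iL$ through Stone's theorem; it is the solution operator of the Cauchy problem $\partial_t f-iLf=0$, $f(x,0)=\varphi(x)$. *)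

theory Defs
  imports "HOL-Analysis.Analysis"
begin

section \<open>The space \<open>L\<^sup>2\<close> of a measure\<close>

text \<open>
  Elements of \<open>L\<^sup>2(M)\<close> are represented by measurable functions; two functions that agree
  almost everywhere stand for the same element.
\<close>

definition L2norm :: "'a measure \<Rightarrow> ('a \<Rightarrow> complex) \<Rightarrow> ennreal" where
  "L2norm M f =
     (let I = (\<integral>\<^sup>+ x. ennreal ((cmod (f x))\<^sup>2) \<partial>M)
      in if I = \<infinity> then \<infinity> else ennreal (sqrt (enn2real I)))"

definition L2 :: "'a measure \<Rightarrow> ('a \<Rightarrow> complex) set" where
  "L2 M = {f \<in> borel_measurable M. L2norm M f < \<infinity>}"

definition L2inner :: "'a measure \<Rightarrow> ('a \<Rightarrow> complex) \<Rightarrow> ('a \<Rightarrow> complex) \<Rightarrow> complex" where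
  "L2inner M f g = (\<integral>x. f x * cnj (g x) \<partial>M)"


section \<open>Unbounded operators and Stone's theorem\<close>

text \<open>
  An unbounded operator in \<open>L\<^sup>2(M)\<close> is given by its graph, a set of pairs of representatives.
\<close>

type_synonym 'a op_graph = "(('a \<Rightarrow> complex) \<times> ('a \<Rightarrow> complex)) set"

definition L2dense :: "'a measure \<Rightarrow> ('a \<Rightarrow> complex) set \<Rightarrow> bool" where
  "L2dense M D \<longleftrightarrow>
     D \<subseteq> L2 M \<and> (\<forall>f\<in>L2 M. \<forall>e>0. \<exists>g\<in>D. L2norm M (\<lambda>x. f x - g x) < e)"

definition adjoint_graph :: "'a measure \<Rightarrow> 'a op_graph \<Rightarrow> 'a op_graph" where
  "adjoint_graph M A =
     {(f, g). f \<in> L2 M \<and> g \<in> L2 M \<and> (\<forall>(u, v)\<in>A. L2inner M v f = L2inner M u g)}"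

text \<open>
  The equation \<open>adjoint_graph M A = A\<close> makes \<open>A\<close> a linear subspace that is closed under changing
  either component on a null set; together with density of the domain it makes \<open>A\<close> single-valued
  up to null sets.
\<close>

definition self_adjoint :: "'a measure \<Rightarrow> 'a op_graph \<Rightarrow> bool" where
  "self_adjoint M A \<longleftrightarrow> L2dense M (Domain A) \<and> adjoint_graph M A = A"

text \<open>
  Linearity and preservation of the inner product imply that \<open>T\<close> respects equality almost
  everywhere, so \<open>T\<close> does act on \<open>L\<^sup>2(M)\<close>.
\<close>

definition unitary_operator :: "'a measure \<Rightarrow> (('a \<Rightarrow> complex) \<Rightarrow> ('a \<Rightarrow> complex)) \<Rightarrow> bool" where
  "unitary_operator M T \<longleftrightarrow>
     (\<forall>f\<in>L2 M. T f \<in> L2 M) \<and>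
     (\<forall>f\<in>L2 M. \<forall>g\<in>L2 M. \<forall>c. AE x in M. T (\<lambda>y. c * f y + g y) x = c * T f x + T g x) \<and>
     (\<forall>f\<in>L2 M. \<forall>g\<in>L2 M. L2inner M (T f) (T g) = L2inner M f g) \<and>
     (\<forall>g\<in>L2 M. \<exists>f\<in>L2 M. AE x in M. T f x = g x)"

definition unitary_group ::
    "'a measure \<Rightarrow> (real \<Rightarrow> ('a \<Rightarrow> complex) \<Rightarrow> ('a \<Rightarrow> complex)) \<Rightarrow> bool" where
  "unitary_group M U \<longleftrightarrow>
     (\<forall>t. unitary_operator M (U t)) \<and>
     (\<forall>f\<in>L2 M. AE x in M. U 0 f x = f x) \<and>
     (\<forall>t r. \<forall>f\<in>L2 M. AE x in M. U (t + r) f x = U t (U r f) x) \<and>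
     (\<forall>f\<in>L2 M. \<forall>r. ((\<lambda>t. L2norm M (\<lambda>x. U t f x - U r f x)) \<longlongrightarrow> 0) (at r))"

definition group_generator ::
    "'a measure \<Rightarrow> (real \<Rightarrow> ('a \<Rightarrow> complex) \<Rightarrow> ('a \<Rightarrow> complex)) \<Rightarrow> 'a op_graph" where
  "group_generator M U =
     {(f, g). f \<in> L2 M \<and> g \<in> L2 M \<and>
        ((\<lambda>t. L2norm M (\<lambda>x. (U t f x - f x) / complex_of_real t - g x)) \<longlongrightarrow> 0) (at 0)}"

text \<open>\<open>U t = exp (\<i> t A)\<close> in the sense of Stone's theorem.\<close>

definition stone_group ::
    "'a measure \<Rightarrow> 'a op_graph \<Rightarrow> (real \<Rightarrow> ('a \<Rightarrow> complex) \<Rightarrow> ('a \<Rightarrow> complex)) \<Rightarrow> bool" where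
  "stone_group M A U \<longleftrightarrow>
     unitary_group M U \<and>
     group_generator M U = {(f, \<lambda>x. \<i> * g x) |f g. (f, g) \<in> A}"


section \<open>The Ornstein-Uhlenbeck operator\<close>

definition gauss :: "(real ^ 'n) measure" where
  "gauss = density lborel (\<lambda>x. ennreal (exp (- (norm x)\<^sup>2 / 2)))"

definition partial_deriv :: "'n \<Rightarrow> (real ^ 'n \<Rightarrow> complex) \<Rightarrow> real ^ 'n \<Rightarrow> complex" where
  "partial_deriv i f x = frechet_derivative f (at x) (axis i 1)"

text \<open>
  All iterated partial derivatives exist and are (totally) differentiable everywhere; this is
  \<open>C\<^sup>\<infinity>\<close>, since it makes all of them continuous.
\<close>

definition smooth :: "(real ^ 'n \<Rightarrow> complex) \<Rightarrow> bool" where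
  "smooth f \<longleftrightarrow> (\<forall>is x. foldr partial_deriv is f differentiable at x)"

definition test_functions :: "(real ^ 'n \<Rightarrow> complex) set" where
  "test_functions = {f. smooth f \<and> compact (closure {x. f x \<noteq> 0})}"

definition ou :: "(real ^ 'n \<Rightarrow> complex) \<Rightarrow> real ^ 'n \<Rightarrow> complex" where
  "ou f x = (\<Sum>i\<in>UNIV. partial_deriv i (partial_deriv i f) x)
          - (\<Sum>i\<in>UNIV. complex_of_real (x $ i) * partial_deriv i f x)"

text \<open>
  The Ornstein-Uhlenbeck operator as a self-adjoint operator: a self-adjoint extension of \<open>ou\<close>
  on the test functions. (\<open>ou\<close> is essentially self-adjoint there, so there is exactly one.)
\<close>

definition ou_self_adjoint :: "(real ^ 'n) op_graph \<Rightarrow> bool" where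
  "ou_self_adjoint L \<longleftrightarrow> self_adjoint gauss L \<and> (\<forall>f\<in>test_functions. (f, ou f) \<in> L)"

end

(*
The functions E z x = exp (z (omega . x) - z^2 / 2), |omega| = 1, are generating functions of Hermite
polynomials, so exp (i t L) maps E z to E (exp (-i t) z). Hence F z = int phi (E z) dgamma, an entire function
of z, satisfies F z = F_s (exp (i s) z), where F_s is formed with f(., s) instead of phi. The two weighted L2
bounds turn into two Gaussian bounds on F. For 16 a b (sin s)^2 = 1 (which may be assumed after decreasing a)
these are, up to a rotation and a factor exp (- q z^2 / 2), the bounds C exp (K (Im z)^2) and C exp (K (Re z)^2),
and the Phragmen-Lindeloef principle makes the function constant. Square integrability, as opposed to
boundedness, of the weighted data makes it decay along a line, so it vanishes. As this holds for all directions
omega, the Fourier transform of phi exp (- |x|^2 / 2) is zero.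
*)

theory Submission
  imports Defs "HOL-Probability.Distributions" "HOL-Complex_Analysis.Conformal_Mappings"
    "HOL-Real_Asymp.Real_Asymp"
begin


text \<open>\<open>ou_self_adjoint\<close> and \<open>stone_group\<close> describe operator and
  group only abstractly, so neither an integral kernel nor a Hermite expansion is at hand. The
  rotation of z is obtained by duality: L (E z) = - z d/dz (E z), so t -> E (exp (-i t) z) solves
  the Cauchy problem, and its pairing with \<open>U t \<phi>\<close> is constant once E z is known
  to lie in the domain of L. That membership is the fact to be extracted from the test functions.
  Origin of 1/16: in w = z^2 the weight a bounds F by an exponent (r |w| + Re (c w)) / 2, half the
  support function of the disc with centre c = -(1 - r) and radius r = 1 / (1 + 4 a). The weight b
  gives such a disc turned by the angle 2 s. The threshold is tangency of the two discs. Why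
  boundedness of the weighted data would not suffice: exp (- beta |x|^2) has transform const exp (q
  z^2 / 2) with q = 1 / (2 beta + 1) - 1, and Re beta = a - 1/4 traces the boundary circle except
  -1. At the point of contact a Gaussian thus meets both weights with constant modulus against
  Lebesgue measure.\<close>

section \<open>The Phragmen-Lindeloef principle\<close>

text \<open>The growth rate 2 is critical for a strip of width pi / 2. This strip is narrower, which
  leaves room for the damping factor exp (- 2 d cosh (p u)) with p > 2 and p A < pi / 2: the first
  condition beats the growth, the second keeps cos (p Im u) positive. At the end d tends to
  0.\<close>

lemma strip_bound:
  fixes g :: "complex \<Rightarrow> complex"
  assumes hol: "g holomorphic_on UNIV" and A: "0 < A" "A < pi / 4"
    and growth: "\<And>u. \<bar>Im u\<bar> \<le> A \<Longrightarrow> norm (g u) \<le> B * exp (K * exp (2 * \<bar>Re u\<bar>))"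
    and edge: "\<And>u. \<bar>Im u\<bar> = A \<Longrightarrow> norm (g u) \<le> C"
    and "C > 0" and u: "\<bar>Im u\<bar> \<le> A"
  shows "norm (g u) \<le> C"
proof -
  \<comment> \<open>A point of the interval 2 < p < pi / (2 A), which is nonempty because A < pi /
    4.\<close>
  define p where "p = 1 + pi / (4 * A)"
  define c where "c = cos (p * A)"
  have p: "p > 2" using A by (simp add: p_def field_simps)
  have pA: "p * A = A + pi / 4" using A by (simp add: p_def field_simps)
  have c: "c > 0" unfolding c_def pA using A by (intro cos_gt_zero_pi) auto
  have cos_ge: "c \<le> cos (p * y)" if "\<bar>y\<bar> \<le> A" for y
  proof -
    have "cos (p * A) \<le> cos \<bar>p * y\<bar>"
      using that A p pA mult_left_mono[OF that, of p] by (intro cos_monotone_0_pi_le) (auto simp: abs_mult)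
    then show ?thesis by (simp add: c_def cos_abs_real)
  qed
  have main: "norm (g u) * exp (- d * cos (p * Im u) * (exp (p * Re u) + exp (- p * Re u))) \<le> C"
    if d: "d > 0" for d
  proof -
    define f where "f = (\<lambda>w. g w * exp (- of_real d * (exp (of_real p * w) + exp (- of_real p * w))))"
    have nf: "norm (f w) = norm (g w) * exp (- d * cos (p * Im w) * (exp (p * Re w) + exp (- p * Re w)))" for w
      by (simp add: f_def norm_mult norm_exp_eq_Re Re_exp algebra_simps)
    have nf_le: "norm (f w) \<le> norm (g w) * exp (- d * c * exp (p * \<bar>Re w\<bar>))" if "\<bar>Im w\<bar> \<le> A" for w
    proof -
      have "exp (p * \<bar>Re w\<bar>) \<le> exp (p * Re w) + exp (- p * Re w)"
        by (cases "Re w \<ge> 0") (auto simp: add_increasing add_increasing2)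
      then have "c * exp (p * \<bar>Re w\<bar>) \<le> cos (p * Im w) * (exp (p * Re w) + exp (- p * Re w))"
        using cos_ge[OF that] c by (intro mult_mono) auto
      then have "- d * cos (p * Im w) * (exp (p * Re w) + exp (- p * Re w)) \<le> - d * c * exp (p * \<bar>Re w\<bar>)"
        using d by simp
      then show ?thesis unfolding nf by (intro mult_left_mono) auto
    qed
    have "((\<lambda>R. B * exp (K * exp (2 * R) - d * c * exp (p * R))) \<longlongrightarrow> 0) at_top"
    proof -
      have "filterlim (\<lambda>R. exp (2 * R) * (e * exp (q * R) - K)) at_top at_top" if "e > 0" "q > 0" for e q :: real
        using that by real_asymp
      from this[of "d * c" "p - 2"]
      have "filterlim (\<lambda>R. exp (2 * R) * (d * c * exp ((p - 2) * R) - K)) at_top at_top"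
        using p d c by simp
      then have "filterlim (\<lambda>R. K * exp (2 * R) - d * c * exp (p * R)) at_bot at_top"
        unfolding filterlim_uminus_at_bot
        by (rule filterlim_cong[THEN iffD1, rotated 3]) (auto simp: algebra_simps exp_add[symmetric])
      then have "((\<lambda>R. exp (K * exp (2 * R) - d * c * exp (p * R))) \<longlongrightarrow> 0) at_top"
        by (rule filterlim_compose[OF exp_at_bot])
      then show ?thesis by (rule tendsto_mult_right_zero)
    qed
    then have "eventually (\<lambda>R. B * exp (K * exp (2 * R) - d * c * exp (p * R)) < C) at_top"
      using \<open>C > 0\<close> by (intro order_tendstoD)
    moreover have "eventually (\<lambda>R. R \<ge> \<bar>Re u\<bar>) at_top" by (rule eventually_ge_at_top)
    ultimately have "eventually (\<lambda>R. B * exp (K * exp (2 * R) - d * c * exp (p * R)) < C \<and> R \<ge> \<bar>Re u\<bar>) at_top"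
      by (rule eventually_conj)
    then obtain R where R: "B * exp (K * exp (2 * R) - d * c * exp (p * R)) < C" "R \<ge> \<bar>Re u\<bar>"
      using eventually_happens[of _ "at_top :: real filter"] by auto
    \<comment> \<open>Maximum modulus on a long box: on the vertical sides the damping beats the
      growth, on the horizontal sides it is at most 1 and \<open>edge\<close> applies.\<close>
    define S where "S = cbox (Complex (- R) (- A)) (Complex R A)"
    have memS: "w \<in> S \<longleftrightarrow> \<bar>Re w\<bar> \<le> R \<and> \<bar>Im w\<bar> \<le> A" for w
      by (auto simp: S_def in_cbox_complex_iff)
    have holf: "f holomorphic_on UNIV"
      unfolding f_def by (intro holomorphic_intros hol)
    have "norm (f u) \<le> C"
    proof (rule maximum_modulus_frontier[of f S])
      show "f holomorphic_on interior S" "continuous_on (closure S) f"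
        using holf holomorphic_on_imp_continuous_on holomorphic_on_subset continuous_on_subset
        by blast+
      show "bounded S" by (simp add: S_def)
      show "u \<in> S" using R u by (simp add: memS)
      fix w assume "w \<in> frontier S"
      then have w: "\<bar>Re w\<bar> \<le> R" "\<bar>Im w\<bar> \<le> A" and or: "\<bar>Re w\<bar> = R \<or> \<bar>Im w\<bar> = A"
        by (auto simp: S_def frontier_cbox in_cbox_complex_iff in_box_complex_iff)
      from or show "norm (f w) \<le> C"
      proof
        assume eq: "\<bar>Re w\<bar> = R"
        have "norm (f w) \<le> B * exp (K * exp (2 * R)) * exp (- d * c * exp (p * R))"
          using nf_le[OF w(2)] growth[OF w(2)] unfolding eq
          by (meson exp_ge_zero mult_right_mono order_trans)
        also have "\<dots> = B * exp (K * exp (2 * R) - d * c * exp (p * R))"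
          by (simp add: exp_diff exp_minus field_simps)
        finally show ?thesis using R by simp
      next
        assume eq: "\<bar>Im w\<bar> = A"
        have "norm (f w) \<le> norm (g w) * exp (- d * c * exp (p * \<bar>Re w\<bar>))"
          using nf_le[OF w(2)] .
        also have "\<dots> \<le> norm (g w) * 1" using d c by (intro mult_left_mono) auto
        finally show ?thesis using edge[OF eq] by simp
      qed
    qed
    then show ?thesis by (simp add: nf)
  qed
  have "((\<lambda>d. norm (g u) * exp (- d * cos (p * Im u) * (exp (p * Re u) + exp (- p * Re u)))) \<longlongrightarrow>
      norm (g u) * exp (- 0 * cos (p * Im u) * (exp (p * Re u) + exp (- p * Re u)))) (at_right 0)"
    by (intro tendsto_intros)
  then have "norm (g u) * exp (- 0 * cos (p * Im u) * (exp (p * Re u) + exp (- p * Re u))) \<le> C"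
    by (rule tendsto_upperbound) (use main in \<open>auto intro!: eventually_at_rightI[of 0 1]\<close>)
  then show ?thesis by simp
qed

text \<open>Order 2 is critical for the opening pi / 2, so the bound on the two axes alone would not
  be enough. The factor exp (i e z^2) has modulus exp (- 2 e x y). In thin sectors along both axes
  it already compensates the Gaussian bound, and the sector that remains has opening less than pi /
  2, where \<open>strip_bound\<close> works. Then e tends to 0.\<close>

lemma quadrant_bound:
  fixes H :: "complex \<Rightarrow> complex"
  assumes hol: "H holomorphic_on UNIV" and "C > 0" "K > 0"
    and bnd: "\<And>z. norm (H z) \<le> C * exp (K * (Im z)\<^sup>2)" "\<And>z. norm (H z) \<le> C * exp (K * (Re z)\<^sup>2)"
    and z: "Re z \<ge> 0" "Im z \<ge> 0"
  shows "norm (H z) \<le> C"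
proof (cases "Re z = 0 \<or> Im z = 0")
  case True
  then show ?thesis using bnd[of z] by auto
next
  case False
  have main: "norm (H z) * exp (- 2 * e * Re z * Im z) \<le> C" if e: "e > 0" for e
  proof -
    \<comment> \<open>\<open>Z\<close> maps the strip |Im u| <= pi / 4 onto the closed first
      quadrant without the origin.\<close>
    define Z where "Z = (\<lambda>u. exp (u + \<i> * of_real pi / 4))"
    define g where "g = (\<lambda>u. H (Z u) * exp (\<i> * of_real e * (Z u)\<^sup>2))"
    have ReZ: "Re (Z u) = exp (Re u) * cos (Im u + pi / 4)"
      and ImZ: "Im (Z u) = exp (Re u) * sin (Im u + pi / 4)" for u
      by (simp_all add: Z_def Re_exp Im_exp)
    have ng: "norm (g u) = norm (H (Z u)) * exp (- 2 * e * Re (Z u) * Im (Z u))" for u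
      by (simp add: g_def norm_mult norm_exp_eq_Re power2_eq_square algebra_simps)
    \<comment> \<open>On the line y = k x the exponents K y^2 and 2 e x y agree; the sectors cut off
      at the axes therefore have angle arctan k.\<close>
    define k where "k = 2 * e / K"
    define A where "A = pi / 4 - arctan k"
    have k: "k > 0" using e \<open>K > 0\<close> by (simp add: k_def)
    have A4: "A < pi / 4" using k by (simp add: A_def)
    have pos: "Re (Z u) \<ge> 0" "Im (Z u) \<ge> 0" if "\<bar>Im u\<bar> \<le> pi / 4" for u
      using that by (auto simp: ReZ ImZ intro!: mult_nonneg_nonneg cos_ge_zero sin_ge_zero)
    have edge: "norm (g u) \<le> C" if "A \<le> \<bar>Im u\<bar>" "\<bar>Im u\<bar> \<le> pi / 4" for u
    proof -
      let ?x = "Re (Z u)" and ?y = "Im (Z u)"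
      have sc: "sin (arctan k) = k * cos (arctan k)"
        using tan_arctan[of k] cos_arctan_not_zero[of k] unfolding tan_def by (simp add: field_simps)
      have ca: "cos (arctan k) > 0" using arctan_bounded[of k] by (intro cos_gt_zero_pi) auto
      have tb: "sin t \<le> k * cos t" if "0 \<le> t" "t \<le> arctan k" for t
      proof -
        have "0 \<le> sin (arctan k - t)" using that arctan_bounded[of k] by (intro sin_ge_zero) auto
        then have "cos (arctan k) * sin t \<le> cos (arctan k) * (k * cos t)"
          by (simp add: sin_diff sc algebra_simps)
        then show ?thesis using ca by simp
      qed
      have "?y \<le> k * ?x \<or> ?x \<le> k * ?y"
      proof (cases "Im u \<ge> 0")
        case True
        then have "sin (pi / 4 - Im u) \<le> k * cos (pi / 4 - Im u)"
          using that by (intro tb) (auto simp: A_def)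
        moreover have "sin (pi / 4 - Im u) = cos (Im u + pi / 4)" "cos (pi / 4 - Im u) = sin (Im u + pi / 4)"
          by (simp_all add: sin_diff cos_diff sin_add cos_add sin_45 cos_45 mult.commute)
        ultimately show ?thesis by (auto simp: ReZ ImZ algebra_simps)
      next
        case False
        then have "sin (Im u + pi / 4) \<le> k * cos (Im u + pi / 4)"
          using that by (intro tb) (auto simp: A_def)
        then show ?thesis by (auto simp: ReZ ImZ algebra_simps)
      qed
      then show ?thesis
      proof
        assume *: "?y \<le> k * ?x"
        have "K * ?y\<^sup>2 \<le> 2 * e * ?x * ?y"
        proof -
          have "K * ?y \<le> 2 * e * ?x" using * \<open>K > 0\<close> by (simp add: k_def field_simps)
          then have "K * ?y * ?y \<le> 2 * e * ?x * ?y" using pos[OF that(2)] by (intro mult_right_mono)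
          then show ?thesis by (simp add: power2_eq_square mult_ac)
        qed
        have "norm (g u) \<le> C * exp (K * ?y\<^sup>2) * exp (- 2 * e * ?x * ?y)"
          unfolding ng using bnd(1)[of "Z u"] by (intro mult_right_mono) auto
        also have "\<dots> = C * exp (K * ?y\<^sup>2 - 2 * e * ?x * ?y)" by (simp add: exp_diff exp_minus field_simps)
        also have "\<dots> \<le> C * 1" using \<open>K * ?y\<^sup>2 \<le> _\<close> \<open>C > 0\<close> by (intro mult_left_mono) auto
        finally show ?thesis by simp
      next
        assume *: "?x \<le> k * ?y"
        have "K * ?x\<^sup>2 \<le> 2 * e * ?x * ?y"
        proof -
          have "K * ?x \<le> 2 * e * ?y" using * \<open>K > 0\<close> by (simp add: k_def field_simps)
          then have "K * ?x * ?x \<le> 2 * e * ?y * ?x" using pos[OF that(2)] by (intro mult_right_mono)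
          then show ?thesis by (simp add: power2_eq_square mult_ac)
        qed
        have "norm (g u) \<le> C * exp (K * ?x\<^sup>2) * exp (- 2 * e * ?x * ?y)"
          unfolding ng using bnd(2)[of "Z u"] by (intro mult_right_mono) auto
        also have "\<dots> = C * exp (K * ?x\<^sup>2 - 2 * e * ?x * ?y)" by (simp add: exp_diff exp_minus field_simps)
        also have "\<dots> \<le> C * 1" using \<open>K * ?x\<^sup>2 \<le> _\<close> \<open>C > 0\<close> by (intro mult_left_mono) auto
        finally show ?thesis by simp
      qed
    qed
    have holg: "g holomorphic_on UNIV"
    proof -
      have "Z holomorphic_on UNIV" unfolding Z_def by (intro holomorphic_intros) auto
      moreover from this have "(\<lambda>u. H (Z u)) holomorphic_on UNIV"
        using holomorphic_on_compose_gen[OF _ hol, of Z UNIV] by (simp add: o_def)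
      ultimately show ?thesis unfolding g_def by (intro holomorphic_intros)
    qed
    define u where "u = Ln z - \<i> * of_real pi / 4"
    have z0: "z \<noteq> 0" using False by auto
    have Zu: "Z u = z" using z0 by (simp add: Z_def u_def)
    have Imu: "\<bar>Im u\<bar> \<le> pi / 4"
    proof -
      have "0 \<le> Im (Ln z)" "Im (Ln z) \<le> pi / 2" "Im u = Im (Ln z) - pi / 4"
        using Im_Ln_pos_le[OF z0] Re_Ln_pos_le[OF z0] z by (auto simp: u_def)
      then show ?thesis by linarith
    qed
    have "norm (g u) \<le> C"
    \<comment> \<open>For large k the number A is not positive; the two thin sectors then cover the
      quadrant and only the first case occurs.\<close>
    proof (cases "A \<le> \<bar>Im u\<bar>")
      case True
      then show ?thesis using edge Imu by blast
    next
      case False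
      show ?thesis
      proof (rule strip_bound[OF holg _ A4 _ _ \<open>C > 0\<close>])
        show "0 < A" "\<bar>Im u\<bar> \<le> A" using False by auto
        show "norm (g u) \<le> C" if "\<bar>Im u\<bar> = A" for u using edge[of u] that A4 by auto
        fix u assume "\<bar>Im u\<bar> \<le> A"
        then have "\<bar>Im u\<bar> \<le> pi / 4" using A4 by auto
        note p = pos[OF this]
        have "norm (g u) \<le> norm (H (Z u)) * 1"
          unfolding ng using p e by (intro mult_left_mono) auto
        also have "\<dots> \<le> C * exp (K * (Im (Z u))\<^sup>2)" using bnd by simp
        also have "\<dots> \<le> C * exp (K * exp (2 * \<bar>Re u\<bar>))"
        proof -
          have "(Im (Z u))\<^sup>2 \<le> (cmod (Z u))\<^sup>2"
            using abs_Im_le_cmod[of "Z u"] by (metis abs_le_square_iff abs_norm_cancel)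
          also have "\<dots> = exp (2 * Re u)" by (simp add: Z_def norm_exp_eq_Re exp_double)
          also have "\<dots> \<le> exp (2 * \<bar>Re u\<bar>)" by simp
          finally show ?thesis using \<open>C > 0\<close> \<open>K > 0\<close> by simp
        qed
        finally show "norm (g u) \<le> C * exp (K * exp (2 * \<bar>Re u\<bar>))" .
      qed
    qed
    then show ?thesis unfolding ng Zu .
  qed
  have "((\<lambda>e. norm (H z) * exp (- 2 * e * Re z * Im z)) \<longlongrightarrow>
      norm (H z) * exp (- 2 * 0 * Re z * Im z)) (at_right 0)"
    by (intro tendsto_intros)
  then have "norm (H z) * exp (- 2 * 0 * Re z * Im z) \<le> C"
    by (rule tendsto_upperbound) (use main in \<open>auto intro!: eventually_at_rightI[of 0 1]\<close>)
  then show ?thesis by simp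
qed

text \<open>With common constants the pair of bounds is invariant under quarter turns, so
  \<open>quadrant_bound\<close> applies in all four quadrants. Liouville makes H constant, and the
  limit identifies the constant.\<close>

lemma entire_eq_0_of_cross_bounds:
  fixes H :: "complex \<Rightarrow> complex"
  assumes hol: "H holomorphic_on UNIV"
    and b1: "\<And>z. norm (H z) \<le> C1 * exp (K1 * (Im z)\<^sup>2)"
    and b2: "\<And>z. norm (H z) \<le> C2 * exp (K2 * (Re z)\<^sup>2)"
    and lim: "((\<lambda>r. H (of_real r)) \<longlongrightarrow> 0) at_top"
  shows "H z = 0"
proof -
  define C where "C = 1 + \<bar>C1\<bar> + \<bar>C2\<bar>"
  define K where "K = 1 + \<bar>K1\<bar> + \<bar>K2\<bar>"
  have CK: "C > 0" "K > 0" by (auto simp: C_def K_def)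
  have le: "c * exp (k * x\<^sup>2) \<le> C * exp (K * x\<^sup>2)" if "c \<le> C" "k \<le> K" for c k x
    using that CK by (intro mult_mono) (auto intro: mult_right_mono)
  have B: "norm (H z) \<le> C * exp (K * (Im z)\<^sup>2)" "norm (H z) \<le> C * exp (K * (Re z)\<^sup>2)" for z
    using order_trans[OF b1 le[of C1 K1]] order_trans[OF b2 le[of C2 K2]]
    by (auto simp: C_def K_def)
  have rot: "norm (H (c * z)) \<le> C" if "c \<in> {1, -1, \<i>, -\<i>}" "Re z \<ge> 0" "Im z \<ge> 0" for c z
  proof (rule quadrant_bound[OF _ CK, where H = "\<lambda>z. H (c * z)"])
    show "(\<lambda>z. H (c * z)) holomorphic_on UNIV"
      using holomorphic_on_compose_gen[OF _ hol, of "\<lambda>z. c * z" UNIV]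
      by (simp add: o_def holomorphic_on_mult)
    show "norm (H (c * w)) \<le> C * exp (K * (Im w)\<^sup>2)" "norm (H (c * w)) \<le> C * exp (K * (Re w)\<^sup>2)" for w
      using that(1) B[of "c * w"] by auto
  qed (use that in auto)
  have "norm (H z) \<le> C" for z
  proof -
    consider "Re z \<ge> 0" "Im z \<ge> 0" | "Re z \<le> 0" "Im z \<ge> 0" | "Re z \<le> 0" "Im z \<le> 0" | "Re z \<ge> 0" "Im z \<le> 0"
      by linarith
    then show ?thesis
      by cases (use rot[of 1 z] rot[of \<i> "-\<i> * z"] rot[of "-1" "-z"] rot[of "-\<i>" "\<i> * z"] in
          \<open>auto simp flip: mult.assoc\<close>)
  qed
  then have "bounded (range H)" by (auto simp: bounded_iff)
  from Liouville_theorem[OF hol this] obtain c where c: "\<And>z. H z = c"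
    by (auto simp: constant_on_def)
  with lim have "c = 0" by (simp add: tendsto_const_iff)
  with c show ?thesis by simp
qed


section \<open>Gaussian integrals and uniqueness of the Fourier transform\<close>

lemma integrable_gaussian:
  fixes l :: real
  assumes "l > 0"
  shows "integrable lborel (\<lambda>x :: 'a :: euclidean_space. exp (- l * (norm x)\<^sup>2))"
proof (rule integrableI_nonneg)
  have 1: "(\<integral>\<^sup>+ t. ennreal (exp (- l * t\<^sup>2)) \<partial>lborel) < \<infinity>"
  proof -
    define \<sigma> where "\<sigma> = 1 / sqrt (2 * l)"
    have \<sigma>: "\<sigma> > 0" "\<sigma>\<^sup>2 = 1 / (2 * l)"
      using assms by (simp_all add: \<sigma>_def power_divide)
    have "integrable lborel (normal_density 0 \<sigma>)" using \<sigma> by simp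
    then have "integrable lborel (\<lambda>t. sqrt (2 * pi * \<sigma>\<^sup>2) * normal_density 0 \<sigma> t)" by simp
    also have "(\<lambda>t. sqrt (2 * pi * \<sigma>\<^sup>2) * normal_density 0 \<sigma> t) = (\<lambda>t. exp (- l * t\<^sup>2))"
      using \<sigma> assms by (auto simp: normal_density_def)
    finally show ?thesis by (subst (asm) integrable_iff_bounded) simp
  qed
  have "(\<integral>\<^sup>+ x. ennreal (exp (- l * (norm x)\<^sup>2)) \<partial>(lborel :: 'a measure))
      = (\<integral>\<^sup>+ x. (\<Prod>b\<in>Basis. ennreal (exp (- l * (x \<bullet> b)\<^sup>2))) \<partial>(lborel :: 'a measure))"
  proof (intro nn_integral_cong)
    fix x :: 'a
    have "(norm x)\<^sup>2 = (\<Sum>b\<in>Basis. (x \<bullet> b)\<^sup>2)"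
      unfolding power2_norm_eq_inner by (subst euclidean_inner) (simp add: power2_eq_square)
    then have "exp (- l * (norm x)\<^sup>2) = (\<Prod>b\<in>Basis. exp (- l * (x \<bullet> b)\<^sup>2))"
      by (simp add: sum_distrib_left exp_sum flip: sum_negf)
    then show "ennreal (exp (- l * (norm x)\<^sup>2)) = (\<Prod>b\<in>Basis. ennreal (exp (- l * (x \<bullet> b)\<^sup>2)))"
      by (simp add: prod_ennreal)
  qed
  also have "\<dots> = (\<Prod>b\<in>(Basis::'a set). \<integral>\<^sup>+ t. ennreal (exp (- l * t\<^sup>2)) \<partial>lborel)"
    by (rule nn_integral_lborel_prod[where f = "\<lambda>_ t. ennreal (exp (- l * t\<^sup>2))"]) auto
  also have "\<dots> < \<infinity>" using 1 by (simp add: power_less_top_ennreal)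
  finally show "(\<integral>\<^sup>+ x. ennreal (exp (- l * (norm x)\<^sup>2)) \<partial>(lborel :: 'a measure)) < \<infinity>" .
qed auto

lemma
  fixes f :: "'a :: euclidean_space \<Rightarrow> 'b :: {banach, second_countable_topology}"
  assumes [measurable]: "f \<in> borel_measurable borel" and "c \<noteq> 0"
  shows integrable_lborel_affine_iff: "integrable lborel (\<lambda>x. f (t + c *\<^sub>R x)) \<longleftrightarrow> integrable lborel f"
    and integral_lborel_affine: "integral\<^sup>L lborel f = \<bar>c\<bar> ^ DIM('a) *\<^sub>R (\<integral>x. f (t + c *\<^sub>R x) \<partial>lborel)"
proof -
  have c: "\<bar>c\<bar> ^ DIM('a) > 0" using \<open>c \<noteq> 0\<close> by simp
  have *: "(lborel :: 'a measure) = density (distr lborel borel (\<lambda>x. t + c *\<^sub>R x)) (\<lambda>_. ennreal (\<bar>c\<bar> ^ DIM('a)))"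
    using lborel_affine[OF \<open>c \<noteq> 0\<close>, of t] by simp
  have "integrable lborel f \<longleftrightarrow> integrable (distr lborel borel (\<lambda>x. t + c *\<^sub>R x)) (\<lambda>x. \<bar>c\<bar> ^ DIM('a) *\<^sub>R f x)"
    by (subst *, subst integrable_density) (auto intro!: AE_I2)
  also have "\<dots> \<longleftrightarrow> integrable lborel (\<lambda>x. f (t + c *\<^sub>R x))"
    using c integrable_scaleR_right[of "inverse (\<bar>c\<bar> ^ DIM('a))" lborel "\<lambda>x. \<bar>c\<bar> ^ DIM('a) *\<^sub>R f (t + c *\<^sub>R x)"]
    by (subst integrable_distr_eq) auto
  finally show "integrable lborel (\<lambda>x. f (t + c *\<^sub>R x)) \<longleftrightarrow> integrable lborel f" by simp
  show "integral\<^sup>L lborel f = \<bar>c\<bar> ^ DIM('a) *\<^sub>R (\<integral>x. f (t + c *\<^sub>R x) \<partial>lborel)"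
    by (subst *, subst integral_density) (auto simp: integral_distr intro!: AE_I2)
qed

lemma integrable_gaussian_centered:
  fixes y :: "'a :: euclidean_space"
  assumes "l > 0"
  shows "integrable lborel (\<lambda>x. exp (- l * (norm (x - y))\<^sup>2))"
  using integrable_lborel_affine_iff[of "\<lambda>x :: 'a. exp (- l * (norm x)\<^sup>2)" 1 "- y"]
    integrable_gaussian[OF assms, where ?'a = 'a] by (simp add: algebra_simps)

lemma integral_gaussian_centered:
  fixes y :: "'a :: euclidean_space"
  shows "(\<integral>x. exp (- l * (norm (x - y))\<^sup>2) \<partial>lborel) = (\<integral>x. exp (- l * (norm x)\<^sup>2) \<partial>(lborel :: 'a measure))"
  using integral_lborel_affine[of "\<lambda>x :: 'a. exp (- l * (norm x)\<^sup>2)" 1 "- y"]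
  by (simp add: algebra_simps)

text \<open>Half of the Gaussian absorbs the linear exponent: c t <= c^2 / (2 l) + l t^2 /
  2.\<close>

lemma integrable_exp_norm_gaussian:
  fixes l c :: real
  assumes "l > 0"
  shows "integrable lborel (\<lambda>x :: 'a :: euclidean_space. exp (c * norm x) * exp (- l * (norm x)\<^sup>2))"
proof (rule Bochner_Integration.integrable_bound)
  show "integrable lborel (\<lambda>x :: 'a. exp (c\<^sup>2 / (2 * l)) * exp (- (l / 2) * (norm x)\<^sup>2))"
    using assms by (intro integrable_mult_right integrable_gaussian) auto
  show "AE x :: 'a in lborel. norm (exp (c * norm x) * exp (- l * (norm x)\<^sup>2))
      \<le> norm (exp (c\<^sup>2 / (2 * l)) * exp (- (l / 2) * (norm x)\<^sup>2))"
  proof (intro AE_I2)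
    fix x :: 'a
    have "0 \<le> (c - l * norm x)\<^sup>2 / (2 * l)" using assms by simp
    also have "\<dots> = c\<^sup>2 / (2 * l) - c * norm x + l / 2 * (norm x)\<^sup>2"
      using assms by (simp add: power2_eq_square field_simps)
    finally show "norm (exp (c * norm x) * exp (- l * (norm x)\<^sup>2))
      \<le> norm (exp (c\<^sup>2 / (2 * l)) * exp (- (l / 2) * (norm x)\<^sup>2))"
      by (simp flip: exp_add)
  qed
qed auto

text \<open>The exponential series is integrated term by term: its partial sums are dominated by exp
  (|z| |l x|) |h x|, which is integrable for every z. The result is a power series converging
  everywhere.\<close>

lemma integral_exp_holomorphic:
  fixes h :: "'a \<Rightarrow> complex" and l :: "'a \<Rightarrow> real"
  assumes [measurable]: "h \<in> borel_measurable M" "l \<in> borel_measurable M"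
    and int: "\<And>c. integrable M (\<lambda>x. exp (c * \<bar>l x\<bar>) * norm (h x))"
  shows "(\<lambda>z. \<integral>x. h x * exp (z * of_real (l x)) \<partial>M) holomorphic_on UNIV"
proof -
  define a where "a = (\<lambda>n. \<integral>x. h x * of_real (l x) ^ n / fact n \<partial>M)"
  have bd: "norm (h x * (z * of_real (l x)) ^ n / fact n) \<le> exp (norm z * \<bar>l x\<bar>) * norm (h x)" for n x z
  proof -
    have "(norm z * \<bar>l x\<bar>) ^ n / fact n \<le> exp (norm z * \<bar>l x\<bar>)"
    proof -
      have "(\<Sum>k\<in>{n}. (norm z * \<bar>l x\<bar>) ^ k /\<^sub>R fact k) \<le> exp (norm z * \<bar>l x\<bar>)"
        unfolding exp_def by (intro sum_le_suminf summable_exp_generic) auto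
      then show ?thesis by (simp add: divide_inverse mult.commute)
    qed
    from mult_left_mono[OF this norm_ge_zero[of "h x"]] show ?thesis
      by (simp add: norm_mult norm_power norm_divide power_mult_distrib mult_ac)
  qed
  have "(\<lambda>n. a n * (z - 0) ^ n) sums (\<integral>x. h x * exp (z * of_real (l x)) \<partial>M)" for z
  proof -
    have intn: "integrable M (\<lambda>x. h x * (z * of_real (l x)) ^ n / fact n)" for n
      by (rule Bochner_Integration.integrable_bound[OF int[of "norm z"]])
        (use bd in auto)
    have an: "a n * (z - 0) ^ n = (\<integral>x. h x * (z * of_real (l x)) ^ n / fact n \<partial>M)" for n
      unfolding a_def by (subst integral_mult_left_zero[symmetric]) (simp add: power_mult_distrib mult_ac)
    have "(\<lambda>n. \<integral>x. (\<Sum>k<n. h x * (z * of_real (l x)) ^ k / fact k) \<partial>M)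
        \<longlonglongrightarrow> (\<integral>x. h x * exp (z * of_real (l x)) \<partial>M)"
    proof (rule integral_dominated_convergence[where w = "\<lambda>x. exp (norm z * \<bar>l x\<bar>) * norm (h x)"])
      show "AE x in M. (\<lambda>n. \<Sum>k<n. h x * (z * of_real (l x)) ^ k / fact k)
          \<longlonglongrightarrow> h x * exp (z * of_real (l x))"
      proof (intro AE_I2)
        fix x
        have "(\<lambda>k. h x * ((z * of_real (l x)) ^ k /\<^sub>R fact k)) sums (h x * exp (z * of_real (l x)))"
          by (intro sums_mult exp_converges)
        then show "(\<lambda>n. \<Sum>k<n. h x * (z * of_real (l x)) ^ k / fact k)
          \<longlonglongrightarrow> h x * exp (z * of_real (l x))"
          by (simp add: sums_def scaleR_conv_of_real divide_inverse mult_ac)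
      qed
      fix n
      show "AE x in M. norm (\<Sum>k<n. h x * (z * of_real (l x)) ^ k / fact k) \<le> exp (norm z * \<bar>l x\<bar>) * norm (h x)"
      proof (intro AE_I2)
        fix x
        have "norm (\<Sum>k<n. h x * (z * of_real (l x)) ^ k / fact k)
            \<le> (\<Sum>k<n. norm (h x) * ((norm z * \<bar>l x\<bar>) ^ k / fact k))"
          by (rule sum_norm_le) (simp add: norm_mult norm_divide norm_power power_mult_distrib)
        also have "\<dots> = norm (h x) * (\<Sum>k<n. (norm z * \<bar>l x\<bar>) ^ k / fact k)"
          by (simp add: sum_distrib_left)
        also have "\<dots> \<le> norm (h x) * exp (norm z * \<bar>l x\<bar>)"
        proof (rule mult_left_mono)
          have "(\<Sum>k<n. (norm z * \<bar>l x\<bar>) ^ k /\<^sub>R fact k) \<le> exp (norm z * \<bar>l x\<bar>)"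
            unfolding exp_def by (intro sum_le_suminf summable_exp_generic) auto
          then show "(\<Sum>k<n. (norm z * \<bar>l x\<bar>) ^ k / fact k) \<le> exp (norm z * \<bar>l x\<bar>)"
            by (simp add: divide_inverse mult.commute)
        qed simp
        finally show "norm (\<Sum>k<n. h x * (z * of_real (l x)) ^ k / fact k) \<le> exp (norm z * \<bar>l x\<bar>) * norm (h x)"
          by (simp add: mult.commute)
      qed
    qed (use int in auto)
    moreover have "(\<integral>x. (\<Sum>k<n. h x * (z * of_real (l x)) ^ k / fact k) \<partial>M) = (\<Sum>k<n. a k * (z - 0) ^ k)" for n
      unfolding an by (rule Bochner_Integration.integral_sum) (rule intn)
    ultimately show ?thesis by (simp only: sums_def)
  qed
  then have hol: "(\<lambda>z. \<integral>x. h x * exp (z * of_real (l x)) \<partial>M) holomorphic_on ball 0 r" for r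
    by (intro power_series_holomorphic) auto
  show ?thesis
    unfolding holomorphic_on_def
  proof
    fix z :: complex
    show "(\<lambda>z. \<integral>x. h x * exp (z * of_real (l x)) \<partial>M) field_differentiable (at z)"
      by (rule holomorphic_on_imp_differentiable_at[OF hol[of "norm z + 1"] open_ball]) simp
  qed
qed

text \<open>The number (2 pi)^(n/2) in dimension n, carried along as a constant to be divided
  out.\<close>

definition gaussian_mass :: "'a :: euclidean_space itself \<Rightarrow> real" where
  "gaussian_mass _ = (\<integral>x. exp (- (norm x)\<^sup>2 / 2) \<partial>(lborel :: 'a measure))"

lemma gaussian_mass_pos: "gaussian_mass TYPE('a :: euclidean_space) > 0"
proof -
  have i: "integrable lborel (\<lambda>x :: 'a. exp (- (norm x)\<^sup>2 / 2))"
    using integrable_gaussian[of "1/2", where ?'a = 'a] by simp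
  have "gaussian_mass TYPE('a) \<noteq> 0"
    unfolding gaussian_mass_def using i
    by (subst integral_nonneg_eq_0_iff_AE) (auto simp: eventually_False ae_filter_eq_bot_iff)
  moreover have "gaussian_mass TYPE('a) \<ge> 0"
    unfolding gaussian_mass_def by (rule integral_nonneg_AE) auto
  ultimately show ?thesis by simp
qed

text \<open>Completing the square gives the formula for real \<open>z\<close>; both sides are entire in \<open>z\<close>.\<close>

lemma fourier_gaussian:
  fixes y :: "'a :: euclidean_space" and z :: complex
  shows "(\<integral>x. of_real (exp (- (norm x)\<^sup>2 / 2)) * exp (z * of_real (y \<bullet> x)) \<partial>lborel)
    = of_real (gaussian_mass TYPE('a)) * exp (z\<^sup>2 * of_real ((norm y)\<^sup>2) / 2)"
proof -
  define f :: "complex \<Rightarrow> complex" where "f = (\<lambda>z. (\<integral>x. of_real (exp (- (norm x)\<^sup>2 / 2)) * exp (z * of_real (y \<bullet> x)) \<partial>(lborel :: 'a measure))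
    - of_real (gaussian_mass TYPE('a)) * exp (z\<^sup>2 * of_real ((norm y)\<^sup>2) / 2))"
  have int: "integrable lborel (\<lambda>x :: 'a. exp (c * \<bar>y \<bullet> x\<bar>) * norm (complex_of_real (exp (- (norm x)\<^sup>2 / 2))))" for c
  proof (rule Bochner_Integration.integrable_bound[OF
        integrable_exp_norm_gaussian[where l = "1/2" and c = "\<bar>c\<bar> * norm y"]])
    show "AE x :: 'a in lborel. norm (exp (c * \<bar>y \<bullet> x\<bar>) * norm (complex_of_real (exp (- (norm x)\<^sup>2 / 2))))
        \<le> norm (exp (\<bar>c\<bar> * norm y * norm x) * exp (- (1 / 2) * (norm x)\<^sup>2))"
    proof (intro AE_I2)
      fix x :: 'a
      have "c * \<bar>y \<bullet> x\<bar> \<le> \<bar>c\<bar> * \<bar>y \<bullet> x\<bar>" by (intro mult_right_mono) auto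
      also have "\<dots> \<le> \<bar>c\<bar> * (norm y * norm x)" by (intro mult_left_mono Cauchy_Schwarz_ineq2) auto
      finally show "norm (exp (c * \<bar>y \<bullet> x\<bar>) * norm (complex_of_real (exp (- (norm x)\<^sup>2 / 2))))
        \<le> norm (exp (\<bar>c\<bar> * norm y * norm x) * exp (- (1 / 2) * (norm x)\<^sup>2))"
        by (simp add: mult.assoc)
    qed
  qed auto
  have "(\<lambda>z. \<integral>x. complex_of_real (exp (- (norm x)\<^sup>2 / 2)) * exp (z * of_real (y \<bullet> x)) \<partial>(lborel :: 'a measure)) holomorphic_on UNIV"
    by (rule integral_exp_holomorphic[OF _ _ int]) measurable
  then have hol: "f holomorphic_on UNIV"
    unfolding f_def by (intro holomorphic_intros) auto
  have real: "f w = 0" if "w \<in> \<real>" for w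
  proof -
    from that obtain r where r: "w = of_real r" by (auto elim: Reals_cases)
    have sq: "- (norm x)\<^sup>2 / 2 + r * (y \<bullet> x) = r\<^sup>2 * (norm y)\<^sup>2 / 2 + - (1/2) * (norm (x - r *\<^sub>R y))\<^sup>2" for x
      by (simp only: power2_norm_eq_inner)
        (simp add: inner_diff_left inner_diff_right inner_commute[of x y] power2_eq_square field_simps)
    have "complex_of_real (exp (- (norm x)\<^sup>2 / 2)) * exp (w * of_real (y \<bullet> x))
        = of_real (exp (r\<^sup>2 * (norm y)\<^sup>2 / 2) * exp (- (1/2) * (norm (x - r *\<^sub>R y))\<^sup>2))" for x
    proof -
      have "complex_of_real (exp (- (norm x)\<^sup>2 / 2)) * exp (w * of_real (y \<bullet> x))
          = of_real (exp (- (norm x)\<^sup>2 / 2 + r * (y \<bullet> x)))"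
        unfolding exp_add by (simp add: r exp_of_real flip: of_real_mult)
      also have "\<dots> = of_real (exp (r\<^sup>2 * (norm y)\<^sup>2 / 2) * exp (- (1/2) * (norm (x - r *\<^sub>R y))\<^sup>2))"
        unfolding sq exp_add ..
      finally show ?thesis .
    qed
    then have "(\<integral>x. of_real (exp (- (norm x)\<^sup>2 / 2)) * exp (w * of_real (y \<bullet> x)) \<partial>(lborel :: 'a measure))
        = of_real (exp (r\<^sup>2 * (norm y)\<^sup>2 / 2) * gaussian_mass TYPE('a))"
      using integral_gaussian_centered[of "1/2" "r *\<^sub>R y"]
      by (simp only: integral_complex_of_real integral_mult_right_zero) (simp add: gaussian_mass_def)
    moreover have "exp (w\<^sup>2 * of_real ((norm y)\<^sup>2) / 2) = complex_of_real (exp (r\<^sup>2 * (norm y)\<^sup>2 / 2))"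
      unfolding exp_of_real[symmetric] by (simp add: r)
    ultimately show "f w = 0" by (simp add: f_def)
  qed
  have lim: "0 islimpt (\<real> :: complex set)"
  proof (rule islimptI)
    fix T :: "complex set" assume "0 \<in> T" "open T"
    then obtain e where e: "e > 0" "ball 0 e \<subseteq> T" by (auto simp: open_contains_ball)
    then have "complex_of_real (e / 2) \<in> T"
      using subsetD[OF e(2), of "of_real (e / 2)"] by simp
    then show "\<exists>y\<in>\<real>. y \<in> T \<and> y \<noteq> 0" using e by (intro bexI[of _ "of_real (e/2)"]) auto
  qed
  have "f z = 0"
    by (rule analytic_continuation[OF hol open_UNIV connected_UNIV subset_UNIV UNIV_I lim real UNIV_I, simplified])
  then show ?thesis by (simp add: f_def)
qed

section \<open>Uniqueness of the Fourier transform of integrable functions\<close>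

lemma integral_swap_dominated:
  fixes K :: "'a :: euclidean_space \<Rightarrow> 'b :: euclidean_space \<Rightarrow> complex"
  assumes [measurable]: "(\<lambda>(x, y). K x y) \<in> borel_measurable (lborel \<Otimes>\<^sub>M lborel)"
    and a: "integrable lborel a" and b: "integrable lborel b"
    and bd: "\<And>x y. norm (K x y) \<le> a x * b y"
  shows "(\<integral>x. \<integral>y. K x y \<partial>lborel \<partial>lborel) = (\<integral>y. \<integral>x. K x y \<partial>lborel \<partial>lborel)"
proof -
  have b': "integrable lborel (\<lambda>y. a x * b y)" for x using b by simp
  have intK: "integrable lborel (\<lambda>y. K x y)" for x
    by (rule Bochner_Integration.integrable_bound[OF b'[of x]])
      (use bd order_trans[OF bd abs_ge_self] in auto)
  have "integrable (lborel \<Otimes>\<^sub>M lborel) (\<lambda>(x, y). K x y)"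
  proof (rule lborel_pair.Fubini_integrable)
    show "integrable lborel (\<lambda>x. \<integral>y. norm (case (x, y) of (x, y) \<Rightarrow> K x y) \<partial>lborel)"
    proof (rule Bochner_Integration.integrable_bound)
      show "integrable lborel (\<lambda>x. a x * (\<integral>y. b y \<partial>lborel))" using a by simp
      show "AE x in lborel. norm (\<integral>y. norm (case (x, y) of (x, y) \<Rightarrow> K x y) \<partial>lborel)
          \<le> norm (a x * (\<integral>y. b y \<partial>lborel))"
      proof (intro AE_I2)
        fix x
        have "(\<integral>y. norm (K x y) \<partial>lborel) \<le> (\<integral>y. a x * b y \<partial>lborel)"
          using intK b' bd by (intro integral_mono) auto
        moreover have "(\<integral>y. norm (K x y) \<partial>lborel) \<ge> 0" by simp
        ultimately show "norm (\<integral>y. norm (case (x, y) of (x, y) \<Rightarrow> K x y) \<partial>lborel)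
          \<le> norm (a x * (\<integral>y. b y \<partial>lborel))" by simp
      qed
    qed measurable
  qed (use intK in auto)
  from lborel_pair.Fubini_integral[OF this] show ?thesis by simp
qed

text \<open>By \<open>fourier_gaussian\<close> at z = i, the Gaussian in x is, up to the mass, the
  Fourier integral of a Gaussian in \<xi>. After Fubini the inner integral is a multiple of the
  Fourier integral of \<psi> at t \<xi>, which is zero.\<close>

lemma integral_mult_gaussian_eq_0:
  fixes \<psi> :: "'a :: euclidean_space \<Rightarrow> complex"
  assumes int: "integrable lborel \<psi>"
    and zero: "\<And>\<xi>. (\<integral>x. \<psi> x * exp (\<i> * of_real (\<xi> \<bullet> x)) \<partial>lborel) = 0"
  shows "(\<integral>x. \<psi> x * of_real (exp (- (norm (t *\<^sub>R (x - y)))\<^sup>2 / 2)) \<partial>lborel) = 0"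
proof -
  have [measurable]: "\<psi> \<in> borel_measurable borel" using int by simp
  define K where "K = (\<lambda>x \<xi>. \<psi> x * (of_real (exp (- (norm \<xi>)\<^sup>2 / 2)) * exp (\<i> * of_real ((t *\<^sub>R (x - y)) \<bullet> \<xi>))))"
  have "(\<integral>x. \<integral>\<xi>. K x \<xi> \<partial>lborel \<partial>lborel) = (\<integral>\<xi>. \<integral>x. K x \<xi> \<partial>lborel \<partial>lborel)"
  proof (rule integral_swap_dominated)
    show "integrable lborel (\<lambda>x. norm (\<psi> x))" using int by simp
    show "integrable lborel (\<lambda>\<xi> :: 'a. exp (- (norm \<xi>)\<^sup>2 / 2))"
      using integrable_gaussian[of "1/2", where ?'a = 'a] by simp
    show "norm (K x \<xi>) \<le> norm (\<psi> x) * exp (- (norm \<xi>)\<^sup>2 / 2)" for x \<xi>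
      by (simp add: K_def norm_mult)
  qed (simp add: K_def)
  moreover have "(\<integral>x. K x \<xi> \<partial>lborel) = 0" for \<xi>
  proof -
    have "K x \<xi> = (of_real (exp (- (norm \<xi>)\<^sup>2 / 2)) * exp (- \<i> * of_real (t * (y \<bullet> \<xi>))))
        * (\<psi> x * exp (\<i> * of_real ((t *\<^sub>R \<xi>) \<bullet> x)))" for x
      by (simp add: K_def inner_diff_left inner_commute[of x] right_diff_distrib exp_diff exp_minus field_simps)
    then show ?thesis using zero[of "t *\<^sub>R \<xi>"] by (simp only: integral_mult_right_zero) simp
  qed
  moreover have "(\<integral>\<xi>. K x \<xi> \<partial>lborel) = of_real (gaussian_mass TYPE('a)) *
      (\<psi> x * of_real (exp (- (norm (t *\<^sub>R (x - y)))\<^sup>2 / 2)))" for x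
  proof -
    have "(\<integral>\<xi>. K x \<xi> \<partial>lborel) = \<psi> x * (of_real (gaussian_mass TYPE('a)) *
        exp (\<i>\<^sup>2 * of_real ((norm (t *\<^sub>R (x - y)))\<^sup>2) / 2))"
      unfolding K_def integral_mult_right_zero fourier_gaussian ..
    also have "exp (\<i>\<^sup>2 * of_real ((norm (t *\<^sub>R (x - y)))\<^sup>2) / 2)
        = complex_of_real (exp (- (norm (t *\<^sub>R (x - y)))\<^sup>2 / 2))"
      unfolding exp_of_real[symmetric] by simp
    finally show ?thesis by (simp only: mult_ac)
  qed
  ultimately show ?thesis
    using gaussian_mass_pos[where ?'a = 'a] by simp
qed

text \<open>Smoothing g by Gaussians of width r reduces the claim, through Fubini, to
  \<open>integral_mult_gaussian_eq_0\<close>; as r tends to 0 the smoothed functions return g times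
  the mass.\<close>

lemma fourier_zero_integral_continuous_eq_0:
  fixes \<psi> :: "'a :: euclidean_space \<Rightarrow> complex" and g :: "'a \<Rightarrow> real"
  assumes int: "integrable lborel \<psi>"
    and zero: "\<And>\<xi>. (\<integral>x. \<psi> x * exp (\<i> * of_real (\<xi> \<bullet> x)) \<partial>lborel) = 0"
    and cont: "continuous_on UNIV g" and bd: "\<And>x. \<bar>g x\<bar> \<le> 1" and intg: "integrable lborel g"
  shows "(\<integral>x. \<psi> x * of_real (g x) \<partial>lborel) = 0"
proof -
  have [measurable]: "\<psi> \<in> borel_measurable borel" using int by simp
  have [measurable]: "g \<in> borel_measurable borel" using cont by (rule borel_measurable_continuous_onI)
  define e where "e = (\<lambda>u :: 'a. exp (- (norm u)\<^sup>2 / 2))"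
  have [measurable]: "e \<in> borel_measurable borel" by (simp add: e_def)
  have inte: "integrable lborel e"
    unfolding e_def using integrable_gaussian[of "1/2", where ?'a = 'a] by simp
  have e01: "0 \<le> e u" "e u \<le> 1" for u by (simp_all add: e_def)
  \<comment> \<open>The convolution after the substitution y = x + r u: r now occurs only in the
    argument of g, so continuity and boundedness of g give the limit by dominated
    convergence.\<close>
  define G where "G = (\<lambda>r x. \<integral>u. g (x + r *\<^sub>R u) * e u \<partial>lborel)"
  have [measurable]: "G r \<in> borel_measurable borel" for r
    unfolding G_def by measurable
  have Gbd: "\<bar>G r x\<bar> \<le> integral\<^sup>L lborel e" for r x
  proof -
    have "norm (G r x) \<le> (\<integral>u. norm (g (x + r *\<^sub>R u) * e u) \<partial>lborel)"
      unfolding G_def by (rule integral_norm_bound)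
    also have "\<dots> \<le> (\<integral>u. e u \<partial>lborel)"
    proof (rule integral_mono')
      show "norm (g (x + r *\<^sub>R u) * e u) \<le> e u" for u
        using bd e01(1)[of u] by (simp add: abs_mult mult_left_le_one_le)
    qed (use inte e01 in auto)
    finally show ?thesis by simp
  qed
  have Glim: "(\<lambda>n. G (1 / Suc n) x) \<longlonglongrightarrow> g x * integral\<^sup>L lborel e" for x
  proof -
    have "(\<lambda>n. \<integral>u. g (x + (1 / Suc n) *\<^sub>R u) * e u \<partial>lborel) \<longlonglongrightarrow> (\<integral>u. g x * e u \<partial>lborel)"
    proof (rule integral_dominated_convergence[OF _ _ inte])
      show "AE u in lborel. (\<lambda>n. g (x + (1 / Suc n) *\<^sub>R u) * e u) \<longlonglongrightarrow> g x * e u"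
      proof (intro AE_I2 tendsto_mult tendsto_const)
        fix u :: 'a
        have "(\<lambda>n. (1 / Suc n) *\<^sub>R u) \<longlonglongrightarrow> 0 *\<^sub>R u"
          using LIMSEQ_inverse_real_of_nat by (intro tendsto_scaleR tendsto_const) (simp add: inverse_eq_divide)
        then have "(\<lambda>n. x + (1 / Suc n) *\<^sub>R u) \<longlonglongrightarrow> x"
          using tendsto_add[OF tendsto_const, of _ 0 sequentially x] by simp
        moreover have "isCont g x" using cont by (simp add: continuous_on_eq_continuous_at)
        ultimately show "(\<lambda>n. g (x + (1 / Suc n) *\<^sub>R u)) \<longlonglongrightarrow> g x" by (rule isCont_tendsto_compose[rotated])
      qed
      show "AE u in lborel. norm (g (x + (1 / Suc n) *\<^sub>R u) * e u) \<le> e u" for n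
        using bd e01(1) by (simp add: abs_mult mult_left_le_one_le)
    qed auto
    then show ?thesis by (simp add: G_def)
  qed
  have zeroG: "(\<integral>x. \<psi> x * of_real (G r x) \<partial>lborel) = 0" if r: "r > 0" for r
  proof -
    define K where "K = (\<lambda>x y. \<psi> x * of_real (g y * e ((1 / r) *\<^sub>R (x - y))))"
    have sym: "g y * e ((1 / r) *\<^sub>R (x - y)) = g y * e ((1 / r) *\<^sub>R (y - x))" for x y
      by (simp add: e_def norm_minus_commute)
    have val: "(\<integral>y. g y * e ((1 / r) *\<^sub>R (y - x)) \<partial>lborel) = r ^ DIM('a) * G r x" for x
      using integral_lborel_affine[of "\<lambda>y. g y * e ((1 / r) *\<^sub>R (y - x))" r x] r
      by (simp add: G_def)
    have "(\<integral>y. K x y \<partial>lborel) = \<psi> x * of_real (r ^ DIM('a) * G r x)" for x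
      unfolding K_def integral_mult_right_zero integral_complex_of_real sym val ..
    then have "of_real (r ^ DIM('a)) * (\<integral>x. \<psi> x * of_real (G r x) \<partial>lborel) = (\<integral>x. \<integral>y. K x y \<partial>lborel \<partial>lborel)"
      by (subst integral_mult_right_zero[symmetric]) (simp add: mult_ac)
    also have "\<dots> = (\<integral>y. \<integral>x. K x y \<partial>lborel \<partial>lborel)"
    proof (rule integral_swap_dominated)
      show "norm (K x y) \<le> norm (\<psi> x) * norm (g y)" for x y
        using e01[of "(1 / r) *\<^sub>R (x - y)"]
        by (auto simp: K_def norm_mult abs_mult intro!: mult_left_mono mult_left_le)
    qed (use int intg in \<open>auto simp: K_def\<close>)
    also have "\<dots> = 0"
    proof -
      have "(\<integral>x. K x y \<partial>lborel) = of_real (g y) * (\<integral>x. \<psi> x * of_real (exp (- (norm ((1 / r) *\<^sub>R (x - y)))\<^sup>2 / 2)) \<partial>lborel)" for y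
        by (subst integral_mult_right_zero[symmetric]) (simp add: K_def e_def mult_ac)
      then show ?thesis
        unfolding integral_mult_gaussian_eq_0[OF int zero] by simp
    qed
    finally show ?thesis using r by simp
  qed
  have "(\<lambda>n. \<integral>x. \<psi> x * of_real (G (1 / Suc n) x) \<partial>lborel)
      \<longlonglongrightarrow> (\<integral>x. \<psi> x * of_real (g x * integral\<^sup>L lborel e) \<partial>lborel)"
  proof (rule integral_dominated_convergence)
    show "integrable lborel (\<lambda>x. norm (\<psi> x) * integral\<^sup>L lborel e)" using int by simp
    show "AE x in lborel. (\<lambda>n. \<psi> x * complex_of_real (G (1 / real (Suc n)) x))
        \<longlonglongrightarrow> \<psi> x * complex_of_real (g x * integral\<^sup>L lborel e)"
      using Glim by (intro AE_I2 tendsto_mult tendsto_const tendsto_of_real)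
    show "AE x in lborel. norm (\<psi> x * complex_of_real (G (1 / real (Suc n)) x)) \<le> norm (\<psi> x) * integral\<^sup>L lborel e" for n
      using Gbd by (intro AE_I2) (simp add: norm_mult mult_left_mono)
  qed auto
  then have "(\<integral>x. \<psi> x * of_real (g x * integral\<^sup>L lborel e) \<partial>lborel) = 0"
    using zeroG by (simp add: LIMSEQ_const_iff)
  moreover have "integral\<^sup>L lborel e > 0"
    using gaussian_mass_pos[where ?'a = 'a] by (simp add: gaussian_mass_def e_def)
  ultimately show ?thesis
    by (simp flip: mult.assoc)
qed

text \<open>From continuous g one passes to indicators of closed sets by the functions max 0 (1 - n
  dist), and to all Borel sets because closed sets form a generator stable under
  intersection.\<close>

lemma fourier_uniqueness:
  fixes \<psi> :: "'a :: euclidean_space \<Rightarrow> complex"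
  assumes int: "integrable lborel \<psi>"
    and zero: "\<And>\<xi>. (\<integral>x. \<psi> x * exp (\<i> * of_real (\<xi> \<bullet> x)) \<partial>lborel) = 0"
  shows "AE x in lborel. \<psi> x = 0"
proof -
  have [measurable]: "\<psi> \<in> borel_measurable borel" using int by simp
  define e where "e = (\<lambda>u :: 'a. exp (- (norm u)\<^sup>2 / 2))"
  have [measurable]: "e \<in> borel_measurable borel" by (simp add: e_def)
  have inte: "integrable lborel e"
    unfolding e_def using integrable_gaussian[of "1/2", where ?'a = 'a] by simp
  have e01: "0 \<le> e u" "e u \<le> 1" for u by (simp_all add: e_def)
  \<comment> \<open>The test functions approximating an indicator need not be integrable. The
    positive factor e makes them so and does not change the zero set of \<psi>.\<close>
  define h where "h = (\<lambda>x. \<psi> x * of_real (e x))"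
  have inth: "integrable lborel h"
    unfolding h_def
    by (rule Bochner_Integration.integrable_bound[OF int]) (use e01 in \<open>auto simp: norm_mult mult_left_le\<close>)
  have cont0: "(\<integral>x. h x * of_real (g x) \<partial>lborel) = 0"
    if g: "continuous_on UNIV g" "\<And>x. 0 \<le> g x" "\<And>x. g x \<le> 1" for g
  proof -
    have [measurable]: "g \<in> borel_measurable borel" using g(1) by (rule borel_measurable_continuous_onI)
    have "(\<integral>x. \<psi> x * of_real (e x * g x) \<partial>lborel) = 0"
    proof (rule fourier_zero_integral_continuous_eq_0[OF int zero])
      show "continuous_on UNIV (\<lambda>x. e x * g x)"
        unfolding e_def by (intro continuous_intros g) auto
      show "\<bar>e x * g x\<bar> \<le> 1" for x
        using e01[of x] g(2,3)[of x] by (simp add: mult_le_one)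
      show "integrable lborel (\<lambda>x. e x * g x)"
        by (rule Bochner_Integration.integrable_bound[OF inte]) (use e01 g in \<open>auto simp: mult_left_le\<close>)
    qed
    then show ?thesis by (simp add: h_def mult_ac)
  qed
  have closed0: "set_lebesgue_integral lborel A h = 0" if A: "closed A" for A
  proof (cases "A = {}")
    case False
    have [measurable]: "A \<in> sets borel" using A by auto
    define g where "g = (\<lambda>(n::nat) x. max 0 (1 - real n * infdist x A))"
    have gc: "continuous_on UNIV (g n)" for n
      unfolding g_def by (intro continuous_intros)
    have [measurable]: "g n \<in> borel_measurable borel" for n
      using gc by (rule borel_measurable_continuous_onI)
    have "(\<lambda>n. \<integral>x. h x * of_real (g n x) \<partial>lborel) \<longlonglongrightarrow> (\<integral>x. h x * of_real (indicator A x) \<partial>lborel)"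
    proof (rule integral_dominated_convergence)
      show "integrable lborel (\<lambda>x. norm (h x))" using inth by simp
      show "AE x in lborel. (\<lambda>n. h x * of_real (g n x)) \<longlonglongrightarrow> h x * of_real (indicator A x)"
      proof (intro AE_I2 tendsto_mult tendsto_of_real tendsto_const)
        fix x
        show "(\<lambda>n. g n x) \<longlonglongrightarrow> indicator A x"
        proof (cases "x \<in> A")
          case True then show ?thesis by (simp add: g_def)
        next
          case False
          then have pos: "infdist x A > 0"
            using in_closed_iff_infdist_zero[OF A \<open>A \<noteq> {}\<close>] infdist_nonneg[of x A] by fastforce
          obtain N :: nat where N: "1 < real N * infdist x A"
            using reals_Archimedean3[OF pos] by blast
          have "eventually (\<lambda>n. g n x = indicator A x) sequentially"
            using eventually_ge_at_top[of N]
          proof eventually_elim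
            case (elim n)
            then have "real N * infdist x A \<le> real n * infdist x A" using pos by simp
            then show ?case using N False by (simp add: g_def)
          qed
          then show ?thesis by (rule tendsto_eventually)
        qed
      qed
      show "AE x in lborel. norm (h x * of_real (g n x)) \<le> norm (h x)" for n
        by (intro AE_I2) (auto simp: norm_mult g_def infdist_nonneg intro!: mult_left_le)
    qed (use inth in auto)
    moreover have "(\<integral>x. h x * of_real (g n x) \<partial>lborel) = 0" for n
      by (rule cont0[OF gc]) (auto simp: g_def infdist_nonneg)
    ultimately show ?thesis
      by (simp add: LIMSEQ_const_iff set_lebesgue_integral_def scaleR_conv_of_real mult.commute)
  qed (simp add: set_lebesgue_integral_def)
  have seth: "set_integrable lborel A h" if "A \<in> sets borel" for A
    using inth that unfolding set_integrable_def by (intro integrable_mult_indicator) auto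
  have "AE x in lborel. h x = 0"
  proof (rule sigma_finite_measure.density_zero[OF sigma_finite_lborel inth])
    fix A :: "'a set" assume "A \<in> sets lborel"
    then have "A \<in> sigma_sets UNIV (Collect closed)" by (simp add: borel_eq_closed)
    then show "set_lebesgue_integral lborel A h = 0"
    proof (induction rule: sigma_sets_induct_disjoint[rotated 2, consumes 1, case_names basic empty compl union])
      case (basic A) then show ?case using closed0 by simp
    next
      case empty show ?case by (simp add: set_lebesgue_integral_def)
    next
      case (compl A)
      then have "A \<in> sets borel" by (simp add: borel_eq_closed)
      then have "set_lebesgue_integral lborel (A \<union> (UNIV - A)) h
          = set_lebesgue_integral lborel A h + set_lebesgue_integral lborel (UNIV - A) h"
        by (intro set_integral_Un seth) auto
      then show ?case using compl closed0[of UNIV] by simp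
    next
      case (union A)
      then have "A i \<in> sets borel" for i by (auto simp: borel_eq_closed)
      then have "set_lebesgue_integral lborel (\<Union>i. A i) h = (\<Sum>i. set_lebesgue_integral lborel (A i) h)"
        using union by (intro lebesgue_integral_countable_add seth)
          (auto simp: disjoint_family_on_def)
      then show ?case using union by simp
    qed (auto simp: Int_stable_def)
  qed
  then show ?thesis by eventually_elim (simp add: h_def e_def)
qed


section \<open>Square-integrable functions\<close>

lemma L2_iff: "f \<in> L2 M \<longleftrightarrow> f \<in> borel_measurable M \<and> integrable M (\<lambda>x. (cmod (f x))\<^sup>2)"
proof -
  have "L2norm M f < \<infinity> \<longleftrightarrow> (\<integral>\<^sup>+ x. ennreal ((cmod (f x))\<^sup>2) \<partial>M) < \<infinity>"
    by (auto simp: L2norm_def Let_def less_top)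
  then show ?thesis
    by (auto simp: L2_def integrable_iff_bounded)
qed

lemma L2_measurable: "f \<in> L2 M \<Longrightarrow> f \<in> borel_measurable M"
  by (simp add: L2_iff)

lemma L2norm_eq:
  assumes "f \<in> L2 M"
  shows "L2norm M f = ennreal (sqrt (\<integral>x. (cmod (f x))\<^sup>2 \<partial>M))"
proof -
  have "(\<integral>\<^sup>+ x. ennreal ((cmod (f x))\<^sup>2) \<partial>M) = ennreal (\<integral>x. (cmod (f x))\<^sup>2 \<partial>M)"
    using assms by (intro nn_integral_eq_integral) (auto simp: L2_iff)
  then show ?thesis by (simp add: L2norm_def Let_def)
qed

text \<open>Bridge from the \<open>ennreal\<close> norms in the definitions of group and generator
  to real integrals, on which all limits are computed.\<close>

lemma tendsto_L2norm_0_iff: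
  assumes "eventually (\<lambda>t. g t \<in> L2 M) F"
  shows "((\<lambda>t. L2norm M (g t)) \<longlongrightarrow> 0) F \<longleftrightarrow> ((\<lambda>t. \<integral>x. (cmod (g t x))\<^sup>2 \<partial>M) \<longlongrightarrow> 0) F"
proof -
  have "((\<lambda>t. L2norm M (g t)) \<longlongrightarrow> 0) F \<longleftrightarrow> ((\<lambda>t. ennreal (sqrt (\<integral>x. (cmod (g t x))\<^sup>2 \<partial>M))) \<longlongrightarrow> ennreal 0) F"
    by (subst ennreal_0, rule filterlim_cong[OF refl refl])
      (use assms in eventually_elim, simp add: L2norm_eq)
  also have "\<dots> \<longleftrightarrow> ((\<lambda>t. sqrt (\<integral>x. (cmod (g t x))\<^sup>2 \<partial>M)) \<longlongrightarrow> 0) F"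
    by (rule tendsto_ennreal_iff) auto
  also have "\<dots> \<longleftrightarrow> ((\<lambda>t. \<integral>x. (cmod (g t x))\<^sup>2 \<partial>M) \<longlongrightarrow> 0) F"
  proof
    assume "((\<lambda>t. sqrt (\<integral>x. (cmod (g t x))\<^sup>2 \<partial>M)) \<longlongrightarrow> 0) F"
    from tendsto_power[OF this, of 2] show "((\<lambda>t. \<integral>x. (cmod (g t x))\<^sup>2 \<partial>M) \<longlongrightarrow> 0) F" by simp
  next
    assume "((\<lambda>t. \<integral>x. (cmod (g t x))\<^sup>2 \<partial>M) \<longlongrightarrow> 0) F"
    from tendsto_real_sqrt[OF this] show "((\<lambda>t. sqrt (\<integral>x. (cmod (g t x))\<^sup>2 \<partial>M)) \<longlongrightarrow> 0) F" by simp
  qed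
  finally show ?thesis .
qed

lemma cmod_diff_square_le: "(cmod (a - b))\<^sup>2 \<le> 2 * (cmod a)\<^sup>2 + 2 * (cmod b)\<^sup>2"
proof -
  have "(cmod (a - b))\<^sup>2 \<le> (cmod a + cmod b)\<^sup>2"
    by (intro power_mono norm_triangle_ineq4) auto
  also have "\<dots> \<le> 2 * (cmod a)\<^sup>2 + 2 * (cmod b)\<^sup>2"
    using sum_squares_bound[of "cmod a" "cmod b"] by (simp add: power2_sum)
  finally show ?thesis .
qed

lemma L2_diff:
  assumes "f \<in> L2 M" "g \<in> L2 M"
  shows "(\<lambda>x. f x - g x) \<in> L2 M"
proof -
  note [measurable] = L2_measurable[OF assms(1)] L2_measurable[OF assms(2)]
  have "integrable M (\<lambda>x. (cmod (f x - g x))\<^sup>2)"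
  proof (rule Bochner_Integration.integrable_bound)
    show "integrable M (\<lambda>x. 2 * (cmod (f x))\<^sup>2 + 2 * (cmod (g x))\<^sup>2)"
      using assms by (auto simp: L2_iff)
  qed (use cmod_diff_square_le in auto)
  then show ?thesis by (simp add: L2_iff)
qed

lemma L2_divide:
  assumes "f \<in> L2 M"
  shows "(\<lambda>x. f x / c) \<in> L2 M"
  using assms by (auto simp: L2_iff norm_divide power_divide)

lemma L2_mult_left:
  assumes "f \<in> L2 M"
  shows "(\<lambda>x. c * f x) \<in> L2 M"
  using assms by (auto simp: L2_iff norm_mult power_mult_distrib)

lemma borel_measurable_cnj [measurable]: "cnj \<in> borel_measurable borel"
  by (intro borel_measurable_continuous_onI continuous_intros)

lemma L2_mult_integrable:
  assumes "f \<in> L2 M" "g \<in> L2 M"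
  shows "integrable M (\<lambda>x. cmod (f x) * cmod (g x))" "integrable M (\<lambda>x. f x * g x)"
    "integrable M (\<lambda>x. f x * cnj (g x))"
proof -
  note [measurable] = L2_measurable[OF assms(1)] L2_measurable[OF assms(2)]
  have i: "integrable M (\<lambda>x. (cmod (f x))\<^sup>2 + (cmod (g x))\<^sup>2)"
    using assms by (auto simp: L2_iff)
  have le: "cmod (f x) * cmod (g x) \<le> \<bar>(cmod (f x))\<^sup>2 + (cmod (g x))\<^sup>2\<bar>" for x
  proof -
    have "2 * cmod (f x) * cmod (g x) \<le> (cmod (f x))\<^sup>2 + (cmod (g x))\<^sup>2"
      by (rule sum_squares_bound)
    moreover have "0 \<le> cmod (f x) * cmod (g x)" by simp
    ultimately show ?thesis by linarith
  qed
  show "integrable M (\<lambda>x. cmod (f x) * cmod (g x))"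
    by (rule Bochner_Integration.integrable_bound[OF i]) (use le in auto)
  show "integrable M (\<lambda>x. f x * g x)" "integrable M (\<lambda>x. f x * cnj (g x))"
    by (rule Bochner_Integration.integrable_bound[OF i]; use le in \<open>auto simp: norm_mult\<close>)+
qed

lemma L2inner_cauchy_schwarz:
  assumes f: "f \<in> L2 M" and g: "g \<in> L2 M"
  shows "cmod (L2inner M f g) \<le> sqrt (\<integral>x. (cmod (f x))\<^sup>2 \<partial>M) * sqrt (\<integral>x. (cmod (g x))\<^sup>2 \<partial>M)"
proof -
  define A where "A = (\<integral>x. (cmod (f x))\<^sup>2 \<partial>M)"
  define B where "B = (\<integral>x. (cmod (g x))\<^sup>2 \<partial>M)"
  define I where "I = (\<integral>x. cmod (f x) * cmod (g x) \<partial>M)"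
  have A0: "A \<ge> 0" and B0: "B \<ge> 0" and I0: "I \<ge> 0"
    by (auto simp: A_def B_def I_def)
  have quad: "0 \<le> t\<^sup>2 * A - 2 * t * I + B" for t
  proof -
    have "0 \<le> (\<integral>x. (t * cmod (f x) - cmod (g x))\<^sup>2 \<partial>M)" by simp
    also have "\<dots> = (\<integral>x. t\<^sup>2 * (cmod (f x))\<^sup>2 - 2 * t * (cmod (f x) * cmod (g x)) + (cmod (g x))\<^sup>2 \<partial>M)"
      by (rule Bochner_Integration.integral_cong) (auto simp: power2_eq_square algebra_simps)
    also have "\<dots> = t\<^sup>2 * A - 2 * t * I + B"
      using f g L2_mult_integrable(1)[OF f g] by (simp add: A_def B_def I_def L2_iff)
    finally show ?thesis .
  qed
  have "I\<^sup>2 \<le> A * B"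
  proof (cases "A = 0")
    case True
    have "I = 0"
    proof (rule ccontr)
      assume "I \<noteq> 0"
      \<comment> \<open>For A = 0 the quadratic is affine in t, and this t gives it the value -1. In
        the other case t = I / A is its minimum.\<close>
      then show False using quad[of "(B + 1) / (2 * I)"] True I0 by simp
    qed
    then show ?thesis using True by simp
  next
    case False
    then have "A > 0" using A0 by simp
    then show ?thesis using quad[of "I / A"] by (simp add: power2_eq_square field_simps)
  qed
  then have "I \<le> sqrt A * sqrt B"
    by (metis real_le_rsqrt real_sqrt_mult)
  moreover have "cmod (L2inner M f g) \<le> I"
    unfolding L2inner_def I_def
    using integral_norm_bound[of M "\<lambda>x. f x * cnj (g x)"] by (simp add: norm_mult)
  ultimately show ?thesis by (simp add: A_def B_def)
qed

lemma L2inner_self: "L2inner M f f = of_real (\<integral>x. (cmod (f x))\<^sup>2 \<partial>M)"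
  unfolding L2inner_def by (simp add: complex_norm_square[symmetric] flip: integral_complex_of_real)

section \<open>Square integrability with respect to the Gaussian measure\<close>

lemma sets_gauss [measurable_cong, simp]: "sets gauss = sets borel"
  and space_gauss [simp]: "space gauss = UNIV"
  by (simp_all add: gauss_def)

lemma borel_measurable_gauss [simp]: "borel_measurable gauss = borel_measurable borel"
  by (rule measurable_cong_sets) auto

lemma
  fixes f :: "real ^ 'n \<Rightarrow> 'b :: {banach, second_countable_topology}"
  assumes [measurable]: "f \<in> borel_measurable borel"
  shows integrable_gauss: "integrable gauss f \<longleftrightarrow> integrable lborel (\<lambda>x. exp (- (norm x)\<^sup>2 / 2) *\<^sub>R f x)"
    and integral_gauss: "integral\<^sup>L gauss f = (\<integral>x. exp (- (norm x)\<^sup>2 / 2) *\<^sub>R f x \<partial>lborel)"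
  unfolding gauss_def by (subst integrable_density integral_density; simp)+

lemma integrable_gauss_exp_norm: "integrable (gauss :: (real ^ 'n) measure) (\<lambda>x. exp (c * norm x))"
  using integrable_exp_norm_gaussian[of "1/2" c, where ?'a = "real ^ 'n"]
  by (simp add: integrable_gauss mult.commute)

lemma L2_gauss_exp_growth:
  assumes [measurable]: "g \<in> borel_measurable borel"
    and bd: "\<And>x :: real ^ 'n. cmod (g x) \<le> B * exp (c * norm x)"
  shows "g \<in> L2 gauss"
proof -
  have "integrable gauss (\<lambda>x. (cmod (g x))\<^sup>2)"
  proof (rule Bochner_Integration.integrable_bound)
    show "integrable gauss (\<lambda>x :: real ^ 'n. B\<^sup>2 * exp ((2 * c) * norm x))"
      by (intro integrable_mult_right integrable_gauss_exp_norm)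
    have "(cmod (g x))\<^sup>2 \<le> (B * exp (c * norm x))\<^sup>2" for x
      using bd by (intro power_mono) auto
    then show "AE x in gauss. norm ((cmod (g x))\<^sup>2) \<le> norm (B\<^sup>2 * exp ((2 * c) * norm x))"
      by (simp add: power_mult_distrib abs_mult mult.assoc flip: exp_double)
  qed simp
  then show ?thesis by (simp add: L2_iff)
qed

text \<open>The majorant B exp (c |x|) lies in L2 of the Gaussian measure, hence its product with
  |u| is integrable and dominates. Pointwise convergence is thus enough for the weak convergence
  used with the cut-offs.\<close>

lemma L2inner_gauss_tendsto:
  assumes u: "u \<in> L2 gauss"
    and [measurable]: "\<And>n. f n \<in> borel_measurable borel" "g \<in> borel_measurable borel"
    and bd: "\<And>n x :: real ^ 'n. cmod (f n x) \<le> B * exp (c * norm x)"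
    and lim: "\<And>x. (\<lambda>n. f n x) \<longlonglongrightarrow> g x"
  shows "(\<lambda>n :: nat. L2inner gauss u (f n)) \<longlonglongrightarrow> L2inner gauss u g"
  unfolding L2inner_def
proof (rule integral_dominated_convergence)
  have [measurable]: "u \<in> borel_measurable borel" using u by (simp add: L2_iff)
  have e: "(\<lambda>x :: real ^ 'n. of_real (B * exp (c * norm x))) \<in> L2 gauss"
    by (rule L2_gauss_exp_growth[of _ "\<bar>B\<bar>" c]) (auto simp: norm_mult)
  show "integrable gauss (\<lambda>x. cmod (u x) * cmod (of_real (B * exp (c * norm x))))"
    by (rule L2_mult_integrable(1)[OF u e])
  show "AE x in gauss. norm (u x * cnj (f n x)) \<le> cmod (u x) * cmod (of_real (B * exp (c * norm x)))" for n
    using order_trans[OF bd abs_ge_self]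
    by (intro AE_I2) (auto simp: norm_mult abs_mult intro!: mult_left_mono)
  show "AE x in gauss. (\<lambda>n. u x * cnj (f n x)) \<longlonglongrightarrow> u x * cnj (g x)"
    using lim by (intro AE_I2 tendsto_intros)
  show "(\<lambda>x. u x * cnj (g x)) \<in> borel_measurable gauss"
    "(\<lambda>x. u x * cnj (f n x)) \<in> borel_measurable gauss" for n by measurable
qed

section \<open>Hermite generating functions in the domain of the Ornstein-Uhlenbeck operator\<close>

text \<open>For k = 0 the standard smooth function vanishing on the negative axis. The index k makes
  the family closed under differentiation up to linear combinations, so smoothness needs no separate
  treatment of higher derivatives.\<close>

definition bump :: "nat \<Rightarrow> real \<Rightarrow> real" where
  "bump k t = (if t \<le> 0 then 0 else exp (- 1 / t) / t ^ k)"

lemma bump_bounds: "0 \<le> bump k t" "bump k t \<le> fact k"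
proof -
  show "0 \<le> bump k t" by (simp add: bump_def)
  show "bump k t \<le> fact k"
  proof (cases "t \<le> 0")
    case False
    \<comment> \<open>A single term of the exponential series, written as a finite sum to be
      compared with the whole series.\<close>
    have "(\<Sum>j\<in>{k}. (1 / t) ^ j /\<^sub>R fact j) \<le> exp (1 / t)"
      unfolding exp_def using False by (intro sum_le_suminf summable_exp_generic) auto
    then show ?thesis using False by (simp add: bump_def exp_minus field_simps)
  qed (simp add: bump_def)
qed

lemma bump_eq_mult: "t \<ge> 0 \<Longrightarrow> bump k t = t ^ j * bump (k + j) t"
  by (simp add: bump_def power_add)

lemma DERIV_bump: "(bump k has_real_derivative (bump (k + 2) t - real k * bump (k + 1) t)) (at t)"
proof -
  consider "t > 0" | "t < 0" | "t = 0" by linarith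
  then show ?thesis
  proof cases
    case 1
    have e: "((\<lambda>t. exp (- 1 / t)) has_real_derivative exp (- 1 / t) / t\<^sup>2) (at t)"
      using 1 by (auto intro!: derivative_eq_intros simp: power2_eq_square)
    have p: "((\<lambda>t. t ^ k) has_real_derivative real k * t ^ k / t) (at t)"
      by (rule DERIV_cong[OF DERIV_pow]) (use 1 in \<open>cases k; simp\<close>)
    have "((\<lambda>t. exp (- 1 / t) / t ^ k) has_real_derivative (bump (k + 2) t - real k * bump (k + 1) t)) (at t)"
      by (rule DERIV_cong[OF DERIV_divide[OF e p]])
        (use 1 in \<open>auto simp: bump_def field_simps power_add power2_eq_square\<close>)
    then show ?thesis
    proof (rule has_field_derivative_transform_within_open)
      show "open {0 :: real <..}" "t \<in> {0<..}" using 1 by auto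
    qed (auto simp: bump_def)
  next
    case 2
    have "((\<lambda>t. 0) has_real_derivative (bump (k + 2) t - real k * bump (k + 1) t)) (at t)"
      using 2 by (simp add: bump_def)
    then show ?thesis
    proof (rule has_field_derivative_transform_within_open)
      show "open {..< 0 :: real}" "t \<in> {..<0}" using 2 by auto
    qed (auto simp: bump_def)
  next
    case 3
    \<comment> \<open>At the junction the quotient is small because \<open>bump k h\<close> = h^2
      \<open>bump (k + 2) h\<close> for h > 0, and the last factor is bounded.\<close>
    have "((\<lambda>h. bump k h / h) \<longlongrightarrow> 0) (at 0)"
    proof (rule Lim_null_comparison)
      show "((\<lambda>h :: real. fact (k + 2) * \<bar>h\<bar>) \<longlongrightarrow> 0) (at 0)"
        by (auto intro!: tendsto_eq_intros)
      have "norm (bump k h / h) \<le> fact (k + 2) * \<bar>h\<bar>" for h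
      proof (cases "h > 0")
        case True
        have "bump k h \<le> h ^ 2 * fact (k + 2)"
          using bump_eq_mult[of h k 2] bump_bounds(2)[of "k + 2" h] True by (simp add: mult_left_mono)
        then show ?thesis using True bump_bounds(1)[of k h] by (simp add: field_simps power2_eq_square)
      next
        case False
        then have "bump k h = 0" by (simp add: bump_def)
        moreover have "0 \<le> fact (k + 2) * \<bar>h\<bar>" by (intro mult_nonneg_nonneg) auto
        ultimately show ?thesis by (metis div_0 norm_zero)
      qed
      then show "eventually (\<lambda>h. norm (bump k h / h) \<le> fact (k + 2) * \<bar>h\<bar>) (at 0)" by simp
    qed
    then show ?thesis using 3 by (simp add: has_field_derivative_iff bump_def)
  qed
qed

section \<open>Calculus of partial derivatives\<close>

text \<open>The total derivative recorded by its coefficients D. It gives both differentiability and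
  the values of \<open>partial_deriv\<close>, and obeys product and chain rules without mentioning
  \<open>frechet_derivative\<close>.\<close>

definition has_partials :: "(real ^ 'n \<Rightarrow> complex) \<Rightarrow> ('n \<Rightarrow> complex) \<Rightarrow> real ^ 'n \<Rightarrow> bool" where
  "has_partials f D x \<longleftrightarrow> (f has_derivative (\<lambda>h. \<Sum>i\<in>UNIV. of_real (h $ i) * D i)) (at x)"

lemma has_partials_differentiable: "has_partials f D x \<Longrightarrow> f differentiable at x"
  by (auto simp: has_partials_def differentiable_def)

lemma has_partials_partial_deriv: "has_partials f D x \<Longrightarrow> partial_deriv i f x = D i"
  unfolding has_partials_def partial_deriv_def
  by (drule frechet_derivative_at, drule sym)
    (simp add: axis_def if_distrib[of of_real] if_distrib[of "\<lambda>a. a * _"] cong: if_cong)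

lemma has_partials_const: "has_partials (\<lambda>x. c) (\<lambda>i. 0) x"
  by (simp add: has_partials_def)

lemma has_partials_add:
  "has_partials f D x \<Longrightarrow> has_partials g E x \<Longrightarrow> has_partials (\<lambda>x. f x + g x) (\<lambda>i. D i + E i) x"
  unfolding has_partials_def
  by (drule (1) has_derivative_add) (simp add: sum.distrib distrib_left)

lemma has_partials_mult:
  "has_partials f D x \<Longrightarrow> has_partials g E x \<Longrightarrow>
    has_partials (\<lambda>x. f x * g x) (\<lambda>i. f x * E i + D i * g x) x"
  unfolding has_partials_def
  by (drule (1) has_derivative_mult)
    (simp add: sum.distrib distrib_left sum_distrib_left sum_distrib_right mult_ac)

lemma inner_vec_sum: "(v :: real ^ 'n) \<bullet> h = (\<Sum>i\<in>UNIV. h $ i * v $ i)"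
  by (simp add: inner_vec_def mult.commute)

lemma has_partials_inner: "has_partials (\<lambda>x. of_real (v \<bullet> x)) (\<lambda>i. of_real (v $ i)) x"
proof -
  have "((\<lambda>x. complex_of_real (v \<bullet> x)) has_derivative (\<lambda>h. of_real (v \<bullet> h))) (at x)"
    by (auto intro!: derivative_eq_intros)
  then show ?thesis by (simp add: has_partials_def inner_vec_sum)
qed

lemma has_partials_coord: "has_partials (\<lambda>x. of_real (x $ j)) (\<lambda>i. if i = j then 1 else 0) x"
proof -
  have "(\<lambda>i. complex_of_real (axis j 1 $ i)) = (\<lambda>i. if i = j then 1 else 0)"
    by (auto simp: axis_def)
  then show ?thesis using has_partials_inner[of "axis j 1" x] by (simp add: inner_axis')
qed

lemma has_partials_exp:
  "has_partials f D x \<Longrightarrow> has_partials (\<lambda>x. exp (f x)) (\<lambda>i. exp (f x) * D i) x"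
  unfolding has_partials_def
  by (drule has_derivative_compose[OF _ DERIV_exp[unfolded has_field_derivative_def]])
    (simp add: sum_distrib_left mult_ac)

lemma has_partials_bump:
  "has_partials (\<lambda>x. of_real (bump k (1 - \<epsilon> * (x \<bullet> x))))
    (\<lambda>i. of_real (bump (k + 2) (1 - \<epsilon> * (x \<bullet> x)) - real k * bump (k + 1) (1 - \<epsilon> * (x \<bullet> x)))
      * (of_real (- 2 * \<epsilon>) * of_real (x $ i))) x"
proof -
  let ?a = "\<lambda>x :: real ^ 'n. 1 - \<epsilon> * (x \<bullet> x)"
  let ?d = "bump (k + 2) (?a x) - real k * bump (k + 1) (?a x)"
  have "(?a has_derivative (\<lambda>h. - 2 * \<epsilon> * (x \<bullet> h))) (at x)"
    by (auto intro!: derivative_eq_intros simp: inner_commute)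
  from has_derivative_compose[OF this DERIV_bump[of k "?a x", unfolded has_field_derivative_def]]
  have "((\<lambda>x. bump k (?a x)) has_derivative (\<lambda>h. ?d * (- 2 * \<epsilon> * (x \<bullet> h)))) (at x)" .
  from has_derivative_of_real[OF this]
  have "((\<lambda>x. complex_of_real (bump k (?a x))) has_derivative (\<lambda>h. of_real (?d * (- 2 * \<epsilon> * (x \<bullet> h))))) (at x)" .
  also have "(\<lambda>h. complex_of_real (?d * (- 2 * \<epsilon> * (x \<bullet> h))))
      = (\<lambda>h. \<Sum>i\<in>UNIV. of_real (h $ i) * (of_real ?d * (of_real (- 2 * \<epsilon>) * of_real (x $ i))))"
    unfolding inner_vec_sum[of x] sum_distrib_left of_real_sum
    by (intro ext sum.cong refl) (simp only: of_real_mult mult_ac)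
  finally show ?thesis by (simp only: has_partials_def)
qed

section \<open>Generating functions, their cut-offs, and the operator on them\<close>

definition coherent :: "real ^ 'n \<Rightarrow> complex \<Rightarrow> real ^ 'n \<Rightarrow> complex" where
  "coherent \<omega> z x = exp (z * of_real (\<omega> \<bullet> x) - z\<^sup>2 / 2)"

text \<open>For a unit vector \<omega> this is the Ornstein-Uhlenbeck expression applied to
  \<open>coherent \<omega> z\<close>: the gradient is z \<omega> times the function, the Laplacian
  z^2 times it. It is also - z d/dz of \<open>coherent \<omega> z\<close>, which is why the
  evolution rotates z.\<close>

definition ou_coherent :: "real ^ 'n \<Rightarrow> complex \<Rightarrow> real ^ 'n \<Rightarrow> complex" where
  "ou_coherent \<omega> z x = (z\<^sup>2 - z * of_real (\<omega> \<bullet> x)) * coherent \<omega> z x"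

lemma coherent_measurable [measurable]: "coherent \<omega> z \<in> borel_measurable borel"
  unfolding coherent_def by measurable

lemma ou_coherent_measurable [measurable]: "ou_coherent \<omega> z \<in> borel_measurable borel"
  unfolding ou_coherent_def by measurable

lemma norm_inner_unit_le: "norm \<omega> = 1 \<Longrightarrow> \<bar>\<omega> \<bullet> x\<bar> \<le> norm x"
  using Cauchy_Schwarz_ineq2[of \<omega> x] by simp

lemma norm_coherent_le:
  assumes "norm \<omega> = 1"
  shows "cmod (coherent \<omega> z x) \<le> exp ((cmod z)\<^sup>2) * exp (cmod z * norm x)"
proof -
  have "Re (z * of_real (\<omega> \<bullet> x) - z\<^sup>2 / 2) \<le> cmod (z * of_real (\<omega> \<bullet> x) - z\<^sup>2 / 2)"
    by (rule complex_Re_le_cmod)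
  also have "\<dots> \<le> cmod (z * of_real (\<omega> \<bullet> x)) + cmod (z\<^sup>2 / 2)"
    by (rule norm_triangle_ineq4)
  also have "\<dots> = cmod z * \<bar>\<omega> \<bullet> x\<bar> + (cmod z)\<^sup>2 / 2"
    by (simp add: norm_mult norm_divide norm_power)
  also have "\<dots> \<le> cmod z * norm x + (cmod z)\<^sup>2"
    using norm_inner_unit_le[OF assms] by (intro add_mono mult_left_mono) auto
  finally show ?thesis
    by (simp add: coherent_def norm_exp_eq_Re add.commute flip: exp_add)
qed

lemma norm_ou_coherent_le:
  assumes "norm \<omega> = 1"
  shows "cmod (ou_coherent \<omega> z x) \<le> ((cmod z)\<^sup>2 + cmod z) * exp ((cmod z)\<^sup>2) * exp ((cmod z + 1) * norm x)"
proof -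
  have "\<bar>\<omega> \<bullet> x\<bar> \<le> exp (norm x)"
    using norm_inner_unit_le[OF assms, of x] exp_ge_add_one_self[of "norm x"] by linarith
  moreover have "cmod (z\<^sup>2 - z * of_real (\<omega> \<bullet> x)) \<le> cmod (z\<^sup>2) + cmod (z * of_real (\<omega> \<bullet> x))"
    by (rule norm_triangle_ineq4)
  ultimately have "cmod (z\<^sup>2 - z * of_real (\<omega> \<bullet> x)) \<le> (cmod z)\<^sup>2 * exp (norm x) + cmod z * exp (norm x)"
    using mult_left_mono[of 1 "exp (norm x)" "(cmod z)\<^sup>2"] mult_left_mono[of "\<bar>\<omega> \<bullet> x\<bar>" "exp (norm x)" "cmod z"]
    by (simp add: norm_mult norm_power)
  then have "cmod (z\<^sup>2 - z * of_real (\<omega> \<bullet> x)) \<le> ((cmod z)\<^sup>2 + cmod z) * exp (norm x)"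
    by (simp add: algebra_simps)
  then have "cmod (ou_coherent \<omega> z x) \<le> ((cmod z)\<^sup>2 + cmod z) * exp (norm x) * (exp ((cmod z)\<^sup>2) * exp (cmod z * norm x))"
    unfolding ou_coherent_def norm_mult using norm_coherent_le[OF assms, of z x]
    by (intro mult_mono) auto
  also have "\<dots> = ((cmod z)\<^sup>2 + cmod z) * exp ((cmod z)\<^sup>2) * exp ((cmod z + 1) * norm x)"
    by (simp add: distrib_right exp_add)
  finally show ?thesis .
qed

lemma coherent_L2: "norm \<omega> = 1 \<Longrightarrow> coherent \<omega> z \<in> L2 gauss"
  by (rule L2_gauss_exp_growth[OF _ norm_coherent_le]) auto

lemma ou_coherent_L2: "norm \<omega> = 1 \<Longrightarrow> ou_coherent \<omega> z \<in> L2 gauss"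
  by (rule L2_gauss_exp_growth[OF _ norm_ou_coherent_le]) auto

lemma has_partials_coherent:
  "has_partials (coherent \<omega> z) (\<lambda>i. (z * of_real (\<omega> $ i)) * coherent \<omega> z x) x"
  using has_partials_exp[OF has_partials_add[OF has_partials_mult[OF has_partials_const[of z]
        has_partials_inner[of \<omega> x]] has_partials_const[of "- z\<^sup>2 / 2"]]]
  by (simp add: coherent_def[abs_def] mult_ac)

text \<open>An algebra of functions containing the cut-offs and closed under partial derivatives.
  Iterated derivatives stay inside it, so one induction over the generators yields
  \<open>smooth\<close>.\<close>

inductive bump_algebra :: "real \<Rightarrow> real ^ 'n \<Rightarrow> complex \<Rightarrow> (real ^ 'n \<Rightarrow> complex) \<Rightarrow> bool"
  for \<epsilon> \<omega> z where
  const: "bump_algebra \<epsilon> \<omega> z (\<lambda>x. c)"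
| coord: "bump_algebra \<epsilon> \<omega> z (\<lambda>x. of_real (x $ j))"
| bump: "bump_algebra \<epsilon> \<omega> z (\<lambda>x. of_real (bump k (1 - \<epsilon> * (x \<bullet> x))))"
| coherent: "bump_algebra \<epsilon> \<omega> z (coherent \<omega> z)"
| add: "bump_algebra \<epsilon> \<omega> z f \<Longrightarrow> bump_algebra \<epsilon> \<omega> z g \<Longrightarrow> bump_algebra \<epsilon> \<omega> z (\<lambda>x. f x + g x)"
| mult: "bump_algebra \<epsilon> \<omega> z f \<Longrightarrow> bump_algebra \<epsilon> \<omega> z g \<Longrightarrow> bump_algebra \<epsilon> \<omega> z (\<lambda>x. f x * g x)"

lemma bump_algebra_partials:
  "bump_algebra \<epsilon> \<omega> z f \<Longrightarrow>
    \<exists>D. (\<forall>x. has_partials f (\<lambda>i. D i x) x) \<and> (\<forall>i. bump_algebra \<epsilon> \<omega> z (D i))"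
proof (induction rule: bump_algebra.induct)
  case (const c)
  then show ?case
    by (intro exI[of _ "\<lambda>i x. 0"]) (auto intro: has_partials_const bump_algebra.const)
next
  case (coord j)
  show ?case
    by (intro exI[of _ "\<lambda>i x. if i = j then 1 else 0"]) (auto intro: has_partials_coord bump_algebra.const)
next
  case (bump k)
  \<comment> \<open>The derivative of the bump with its difference written as a sum, since the
    algebra is generated by sums, products and constants.\<close>
  have "bump_algebra \<epsilon> \<omega> z (\<lambda>x. (of_real (bump (k + 2) (1 - \<epsilon> * (x \<bullet> x)))
      + of_real (- real k) * of_real (bump (k + 1) (1 - \<epsilon> * (x \<bullet> x))))
      * (of_real (- 2 * \<epsilon>) * of_real (x $ i)))" for i
    by (intro bump_algebra.intros)
  then show ?case
    by (intro exI[of _ "\<lambda>i x. of_real (bump (k + 2) (1 - \<epsilon> * (x \<bullet> x)) - real k * bump (k + 1) (1 - \<epsilon> * (x \<bullet> x)))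
      * (of_real (- 2 * \<epsilon>) * of_real (x $ i))"] conjI allI has_partials_bump) simp
next
  case coherent
  show ?case
    by (intro exI[of _ "\<lambda>i x. (z * of_real (\<omega> $ i)) * coherent \<omega> z x"] conjI allI
        has_partials_coherent bump_algebra.intros)
next
  case (add f g)
  then obtain D E where "\<And>x. has_partials f (\<lambda>i. D i x) x" "\<And>i. bump_algebra \<epsilon> \<omega> z (D i)"
      "\<And>x. has_partials g (\<lambda>i. E i x) x" "\<And>i. bump_algebra \<epsilon> \<omega> z (E i)" by blast
  then show ?case
    by (intro exI[of _ "\<lambda>i x. D i x + E i x"] conjI allI has_partials_add bump_algebra.intros)
next
  case (mult f g)
  then obtain D E where "\<And>x. has_partials f (\<lambda>i. D i x) x" "\<And>i. bump_algebra \<epsilon> \<omega> z (D i)"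
      "\<And>x. has_partials g (\<lambda>i. E i x) x" "\<And>i. bump_algebra \<epsilon> \<omega> z (E i)" by blast
  then show ?case using mult.hyps
    by (intro exI[of _ "\<lambda>i x. f x * E i x + D i x * g x"] conjI allI has_partials_mult bump_algebra.intros)
qed

lemma bump_algebra_smooth:
  assumes "bump_algebra \<epsilon> \<omega> z f"
  shows "smooth f"
proof -
  have "bump_algebra \<epsilon> \<omega> z (partial_deriv i g)" if "bump_algebra \<epsilon> \<omega> z g" for g i
  proof -
    from bump_algebra_partials[OF that] obtain D
      where D: "\<And>x. has_partials g (\<lambda>i. D i x) x" "\<And>i. bump_algebra \<epsilon> \<omega> z (D i)" by blast
    then have "partial_deriv i g = D i" by (intro ext has_partials_partial_deriv)
    then show ?thesis using D by simp
  qed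
  then have "bump_algebra \<epsilon> \<omega> z (foldr partial_deriv is f)" for "is"
    using assms by (induction "is") auto
  then show ?thesis
    unfolding smooth_def by (meson bump_algebra_partials has_partials_differentiable)
qed

text \<open>For \<epsilon> > 0 the support lies in the ball of radius \<epsilon>^(-1/2). As
  \<epsilon> tends to 0 the cut-off tends pointwise to \<open>bump 0 1\<close> = exp (-1) times
  \<open>coherent\<close>.\<close>

definition cutoff :: "real \<Rightarrow> real ^ 'n \<Rightarrow> complex \<Rightarrow> real ^ 'n \<Rightarrow> complex" where
  "cutoff \<epsilon> \<omega> z x = of_real (bump 0 (1 - \<epsilon> * (x \<bullet> x))) * coherent \<omega> z x"

lemma cutoff_test_function:
  assumes "\<epsilon> > 0"
  shows "cutoff \<epsilon> \<omega> z \<in> test_functions"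
proof -
  have "{x. cutoff \<epsilon> \<omega> z x \<noteq> 0} \<subseteq> cball 0 (sqrt (1 / \<epsilon>))"
  proof
    fix x assume "x \<in> {x. cutoff \<epsilon> \<omega> z x \<noteq> 0}"
    then have "\<epsilon> * (norm x)\<^sup>2 < 1"
      by (auto simp: cutoff_def bump_def power2_norm_eq_inner split: if_splits)
    then have "(norm x)\<^sup>2 \<le> 1 / \<epsilon>" using assms by (simp add: field_simps)
    then have "norm x \<le> sqrt (1 / \<epsilon>)" by (simp add: real_le_rsqrt)
    then show "x \<in> cball 0 (sqrt (1 / \<epsilon>))" by simp
  qed
  then have "bounded {x. cutoff \<epsilon> \<omega> z x \<noteq> 0}" using bounded_cball bounded_subset by blast
  moreover have "bump_algebra \<epsilon> \<omega> z (cutoff \<epsilon> \<omega> z)"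
    unfolding cutoff_def[abs_def] by (intro bump_algebra.intros)
  ultimately show ?thesis
    by (simp add: test_functions_def bump_algebra_smooth compact_closure)
qed

text \<open>The form matters: every term in which a derivative hits the bump carries a factor
  \<epsilon>, so the limit as \<epsilon> tends to 0 can be read off.\<close>

lemma ou_cutoff:
  fixes \<omega> x :: "real ^ 'n" and \<epsilon> :: real
  assumes "norm \<omega> = 1"
  defines "b \<equiv> \<lambda>k. complex_of_real (bump k (1 - \<epsilon> * (x \<bullet> x)))"
    and "s \<equiv> complex_of_real (\<omega> \<bullet> x)" and "q \<equiv> complex_of_real (x \<bullet> x)"
  shows "ou (cutoff \<epsilon> \<omega> z) x = (b 0 * (z\<^sup>2 - z * s)
    + of_real \<epsilon> * (4 * of_real \<epsilon> * (b 4 - 2 * b 3) * q - 4 * z * s * b 2 - 2 * of_nat CARD('n) * b 2 + 2 * q * b 2))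
    * coherent \<omega> z x"
proof -
  define B where "B = (\<lambda>k (x :: real ^ 'n). complex_of_real (bump k (1 - \<epsilon> * (x \<bullet> x))))"
  define e where "e = complex_of_real \<epsilon>"
  define w where "w = (\<lambda>i. complex_of_real (\<omega> $ i))"
  define X where "X = (\<lambda>i. complex_of_real (x $ i))"
  have Bp: "has_partials (B k) (\<lambda>i. (B (k + 2) y - of_nat k * B (k + 1) y) * (- 2 * e * of_real (y $ i))) y" for k y
    using has_partials_bump[of k \<epsilon> y] by (simp add: B_def e_def)
  define P where "P = (\<lambda>i y. (B 0 y * (z * w i) + B 2 y * (- 2 * e * of_real (y $ i))) * coherent \<omega> z y)"
  have "has_partials (cutoff \<epsilon> \<omega> z) (\<lambda>i. P i y) y" for y
    using has_partials_mult[OF Bp[of 0 y] has_partials_coherent[of \<omega> z y]]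
    by (simp add: cutoff_def[abs_def] B_def P_def w_def algebra_simps numeral_2_eq_2)
  then have P1: "partial_deriv i (cutoff \<epsilon> \<omega> z) = P i" for i
    by (intro ext has_partials_partial_deriv)
  have P2: "partial_deriv i (P i) x = ((B 2 x * (- 2 * e * X i) * (z * w i)
      + ((B 4 x - 2 * B 3 x) * (- 2 * e * X i) * (- 2 * e * X i) + B 2 x * (- 2 * e)))
      + (B 0 x * (z * w i) + B 2 x * (- 2 * e * X i)) * (z * w i)) * coherent \<omega> z x" for i
    unfolding P_def
    by (rule trans[OF has_partials_partial_deriv[OF has_partials_mult[OF has_partials_add[OF
                has_partials_mult[OF Bp has_partials_const]
                has_partials_mult[OF Bp has_partials_mult[OF has_partials_const has_partials_coord]]]
              has_partials_coherent]]])
      (simp add: X_def w_def algebra_simps eval_nat_numeral)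
  have sums: "(\<Sum>i\<in>UNIV. X i * w i) = s" "(\<Sum>i\<in>UNIV. X i * X i) = q" "(\<Sum>i\<in>UNIV. w i * w i) = 1"
    using assms(1) by (simp_all add: X_def w_def s_def q_def inner_vec_def mult.commute norm_eq_1 flip: of_real_mult of_real_sum)
  have Xx: "complex_of_real (x $ i) = X i" for i by (simp add: X_def)
  have Bb: "B k x = b k" for k by (simp add: B_def b_def)
  have "ou (cutoff \<epsilon> \<omega> z) x = (\<Sum>i\<in>UNIV. partial_deriv i (P i) x - X i * P i x)"
    by (simp add: ou_def P1 sum_subtractf X_def)
  also have "\<dots> = (\<Sum>i\<in>UNIV. (- 4 * e * z * b 2 * coherent \<omega> z x - z * b 0 * coherent \<omega> z x) * (X i * w i)
      + (4 * e\<^sup>2 * (b 4 - 2 * b 3) + 2 * e * b 2) * coherent \<omega> z x * (X i * X i)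
      + z\<^sup>2 * b 0 * coherent \<omega> z x * (w i * w i) - 2 * e * b 2 * coherent \<omega> z x)"
    by (rule sum.cong[OF refl])
      (simp add: P2 Bb, simp add: P_def Bb Xx power2_eq_square algebra_simps)
  also have "\<dots> = (- 4 * e * z * b 2 * coherent \<omega> z x - z * b 0 * coherent \<omega> z x) * s
      + (4 * e\<^sup>2 * (b 4 - 2 * b 3) + 2 * e * b 2) * coherent \<omega> z x * q
      + z\<^sup>2 * b 0 * coherent \<omega> z x * 1 - of_nat CARD('n) * (2 * e * b 2 * coherent \<omega> z x)"
    by (simp only: sum.distrib sum_subtractf sum_distrib_left[symmetric] sums sum_constant)
      (simp only: mult_ac)
  finally show ?thesis
    by (simp add: e_def power2_eq_square algebra_simps)
qed

text \<open>A majorant uniform in \<epsilon>, for dominated convergence. With X = exp |x| one has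
  |\<omega> . x| <= X and |x|^2 <= 2 X, and \<open>bump k\<close> is at most k!. Hence 9 = 1 + 8,
  296 = 4 (24 + 2 * 6) * 2 + 8, and 4 in front of the dimension.\<close>

lemma norm_ou_cutoff_le:
  fixes \<omega> x :: "real ^ 'n"
  assumes \<omega>: "norm \<omega> = 1" and \<epsilon>: "0 < \<epsilon>" "\<epsilon> \<le> 1"
  shows "cmod (ou (cutoff \<epsilon> \<omega> z) x)
    \<le> ((cmod z)\<^sup>2 + 9 * cmod z + 296 + 4 * CARD('n)) * exp ((cmod z)\<^sup>2) * exp ((cmod z + 1) * norm x)"
proof -
  define b where "b = (\<lambda>k. complex_of_real (bump k (1 - \<epsilon> * (x \<bullet> x))))"
  define s where "s = complex_of_real (\<omega> \<bullet> x)"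
  define q where "q = complex_of_real (x \<bullet> x)"
  define X where "X = exp (norm x)"
  have X: "1 \<le> X" "norm x \<le> X" using exp_ge_add_one_self[of "norm x"] norm_ge_zero[of x] unfolding X_def by linarith+
  have X2: "(norm x)\<^sup>2 \<le> 2 * X"
    using exp_lower_Taylor_quadratic[of "norm x"] norm_ge_zero[of x] unfolding X_def by linarith
  have bk: "cmod (b k) \<le> fact k" for k
    using bump_bounds[of k "1 - \<epsilon> * (x \<bullet> x)"] by (simp add: b_def)
  have b0: "cmod (b 0) \<le> 1" and b2: "cmod (b 2) \<le> 2" and b3: "cmod (b 3) \<le> 6" and b4: "cmod (b 4) \<le> 24"
    using bk[of 0] bk[of 2] bk[of 3] bk[of 4] by (simp_all add: fact_numeral)
  have s: "cmod s \<le> X" using norm_inner_unit_le[OF \<omega>, of x] X by (simp add: s_def)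
  have q: "cmod q \<le> 2 * X" using X2 by (simp add: q_def power2_norm_eq_inner)
  have t1: "cmod (b 0 * (z\<^sup>2 - z * s)) \<le> 1 * ((cmod z)\<^sup>2 * X + cmod z * X)"
  proof -
    have "cmod (z\<^sup>2 - z * s) \<le> (cmod z)\<^sup>2 * 1 + cmod z * cmod s"
      using norm_triangle_ineq4[of "z\<^sup>2" "z * s"] by (simp add: norm_mult norm_power)
    also have "\<dots> \<le> (cmod z)\<^sup>2 * X + cmod z * X" using X s by (intro add_mono mult_left_mono) auto
    finally show ?thesis unfolding norm_mult using b0 by (intro mult_mono) auto
  qed
  have t2: "cmod (4 * of_real \<epsilon> * (b 4 - 2 * b 3) * q) \<le> 4 * 1 * 36 * (2 * X)"
  proof -
    have "cmod (b 4 - 2 * b 3) \<le> 36"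
      using norm_triangle_ineq4[of "b 4" "2 * b 3"] b3 b4 by (simp add: norm_mult)
    then show ?thesis unfolding norm_mult using \<epsilon> q X by (intro mult_mono) auto
  qed
  have t3: "cmod (4 * z * s * b 2) \<le> 4 * cmod z * X * 2"
    unfolding norm_mult using s b2 X by (intro mult_mono) auto
  have t4: "cmod (2 * of_nat CARD('n) * b 2) \<le> 2 * CARD('n) * (2 * X)"
    unfolding norm_mult using b2 X by (intro mult_mono) auto
  have t5: "cmod (2 * q * b 2) \<le> 2 * (2 * X) * 2"
    unfolding norm_mult using b2 q X by (intro mult_mono) auto
  define R where "R = 4 * of_real \<epsilon> * (b 4 - 2 * b 3) * q - 4 * z * s * b 2 - 2 * of_nat CARD('n) * b 2 + 2 * q * b 2"
  have "cmod R \<le> 4 * 1 * 36 * (2 * X) + 4 * cmod z * X * 2 + 2 * CARD('n) * (2 * X) + 2 * (2 * X) * 2"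
    unfolding R_def by (intro norm_triangle_le norm_triangle_le_diff add_mono t2 t3 t4 t5)
  then have "cmod (of_real \<epsilon> * R) \<le> 4 * 1 * 36 * (2 * X) + 4 * cmod z * X * 2 + 2 * CARD('n) * (2 * X) + 2 * (2 * X) * 2"
    using \<epsilon> mult_right_mono[of \<epsilon> 1 "cmod R"] by (simp add: norm_mult)
  then have "cmod (b 0 * (z\<^sup>2 - z * s) + of_real \<epsilon> * R) \<le> ((cmod z)\<^sup>2 + 9 * cmod z + 296 + 4 * CARD('n)) * X"
    using t1 norm_triangle_ineq[of "b 0 * (z\<^sup>2 - z * s)" "of_real \<epsilon> * R"] by (simp add: algebra_simps)
  then have "cmod (b 0 * (z\<^sup>2 - z * s) + of_real \<epsilon> * R) * cmod (coherent \<omega> z x)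
      \<le> ((cmod z)\<^sup>2 + 9 * cmod z + 296 + 4 * CARD('n)) * X * (exp ((cmod z)\<^sup>2) * exp (cmod z * norm x))"
    using X by (intro mult_mono norm_coherent_le \<omega>) auto
  also have "\<dots> = ((cmod z)\<^sup>2 + 9 * cmod z + 296 + 4 * CARD('n)) * exp ((cmod z)\<^sup>2) * exp ((cmod z + 1) * norm x)"
    by (simp add: X_def distrib_right exp_add)
  finally show ?thesis
    unfolding ou_cutoff[OF \<omega>] norm_mult[symmetric] R_def b_def s_def q_def .
qed

text \<open>The cut-offs converge to a multiple of \<open>coherent\<close>, and a self-adjoint operator is closed.\<close>

lemma coherent_in_ou:
  fixes L :: "(real ^ 'n) op_graph"
  assumes L: "ou_self_adjoint L" and \<omega>: "norm \<omega> = 1"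
  shows "(coherent \<omega> z, ou_coherent \<omega> z) \<in> L"
proof -
  have adj: "adjoint_graph gauss L = L" and test: "\<And>f. f \<in> test_functions \<Longrightarrow> (f, ou f) \<in> L"
    using L by (auto simp: ou_self_adjoint_def self_adjoint_def)
  define \<epsilon> where "\<epsilon> = (\<lambda>n. inverse (real (Suc n)))"
  have \<epsilon>: "0 < \<epsilon> n" "\<epsilon> n \<le> 1" for n by (auto simp: \<epsilon>_def field_simps)
  have \<epsilon>0: "\<epsilon> \<longlonglongrightarrow> 0" unfolding \<epsilon>_def by (rule LIMSEQ_inverse_real_of_nat)
  have bk: "(\<lambda>n. complex_of_real (bump k (1 - \<epsilon> n * (x \<bullet> x)))) \<longlonglongrightarrow> of_real (bump k 1)" for k and x :: "real ^ 'n"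
  proof -
    have "(\<lambda>n. 1 - \<epsilon> n * (x \<bullet> x)) \<longlonglongrightarrow> 1 - 0 * (x \<bullet> x)" by (intro tendsto_intros \<epsilon>0)
    then show ?thesis
      using isCont_tendsto_compose[OF DERIV_isCont[OF DERIV_bump[of k 1]]] by (intro tendsto_of_real) auto
  qed
  have in_L: "(cutoff (\<epsilon> n) \<omega> z, ou (cutoff (\<epsilon> n) \<omega> z)) \<in> L" for n
    by (intro test cutoff_test_function \<epsilon>)
  then have in_L2: "cutoff (\<epsilon> n) \<omega> z \<in> L2 gauss" "ou (cutoff (\<epsilon> n) \<omega> z) \<in> L2 gauss" for n
    by (subst (asm) adj[symmetric], simp add: adjoint_graph_def)+
  \<comment> \<open>Membership in L is membership in its adjoint, which asks only for inner products
    against elements of L; weak limits of the cut-offs therefore suffice.\<close>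
  have "L2inner gauss v (coherent \<omega> z) = L2inner gauss u (ou_coherent \<omega> z)" if "(u, v) \<in> L" for u v
  proof -
    have uv: "u \<in> L2 gauss" "v \<in> L2 gauss"
      using that by (subst (asm) adj[symmetric], simp add: adjoint_graph_def)+
    \<comment> \<open>The value of the bump in the limit, exp (-1); being nonzero it cancels at the
      end.\<close>
    let ?c = "complex_of_real (bump 0 1)"
    have "(\<lambda>n. L2inner gauss v (cutoff (\<epsilon> n) \<omega> z)) \<longlonglongrightarrow> L2inner gauss v (\<lambda>x. ?c * coherent \<omega> z x)"
    proof (rule L2inner_gauss_tendsto[OF uv(2)])
      fix n x
      have "cmod (cutoff (\<epsilon> n) \<omega> z x) \<le> 1 * (exp ((cmod z)\<^sup>2) * exp (cmod z * norm x))"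
        unfolding cutoff_def norm_mult using bump_bounds[of 0 "1 - \<epsilon> n * (x \<bullet> x)"]
        by (intro mult_mono norm_coherent_le \<omega>) auto
      then show "cmod (cutoff (\<epsilon> n) \<omega> z x) \<le> exp ((cmod z)\<^sup>2) * exp (cmod z * norm x)" by simp
    next
      show "(\<lambda>n. cutoff (\<epsilon> n) \<omega> z x) \<longlonglongrightarrow> ?c * coherent \<omega> z x" for x
        unfolding cutoff_def by (intro tendsto_intros bk)
    qed (use in_L2 in \<open>auto simp: L2_iff\<close>)
    moreover have "(\<lambda>n. L2inner gauss u (ou (cutoff (\<epsilon> n) \<omega> z))) \<longlonglongrightarrow> L2inner gauss u (\<lambda>x. ?c * ou_coherent \<omega> z x)"
    proof (rule L2inner_gauss_tendsto[OF uv(1)])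
      show "cmod (ou (cutoff (\<epsilon> n) \<omega> z) x) \<le> ((cmod z)\<^sup>2 + 9 * cmod z + 296 + 4 * CARD('n)) * exp ((cmod z)\<^sup>2) * exp ((cmod z + 1) * norm x)" for n x
        by (rule norm_ou_cutoff_le[OF \<omega> \<epsilon>])
      have e0: "(\<lambda>n. complex_of_real (\<epsilon> n)) \<longlonglongrightarrow> 0"
        using tendsto_of_real[OF \<epsilon>0, where ?'a = complex] by simp
      show "(\<lambda>n. ou (cutoff (\<epsilon> n) \<omega> z) x) \<longlonglongrightarrow> ?c * ou_coherent \<omega> z x" for x
        unfolding ou_cutoff[OF \<omega>] ou_coherent_def
        by (rule tendsto_eq_intros bk e0 refl | simp)+
    qed (use in_L2 in \<open>auto simp: L2_iff\<close>)
    \<comment> \<open>Symmetry of L: the cut-off pair belongs to L, hence to the adjoint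
      graph.\<close>
    moreover have "L2inner gauss v (cutoff (\<epsilon> n) \<omega> z) = L2inner gauss u (ou (cutoff (\<epsilon> n) \<omega> z))" for n
      using in_L[of n] that by (subst (asm) adj[symmetric]) (auto simp: adjoint_graph_def)
    ultimately have "L2inner gauss v (\<lambda>x. ?c * coherent \<omega> z x) = L2inner gauss u (\<lambda>x. ?c * ou_coherent \<omega> z x)"
      using LIMSEQ_unique by simp blast
    moreover have "L2inner gauss a (\<lambda>x. ?c * g x) = ?c * L2inner gauss a g" for a g
      unfolding L2inner_def by (subst integral_mult_right_zero[symmetric]) (simp add: mult_ac)
    moreover have "?c \<noteq> 0" by (simp add: bump_def)
    ultimately show ?thesis by (metis mult_left_cancel)
  qed
  then have "(coherent \<omega> z, ou_coherent \<omega> z) \<in> adjoint_graph gauss L"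
    using coherent_L2[OF \<omega>] ou_coherent_L2[OF \<omega>] by (auto simp: adjoint_graph_def)
  then show ?thesis by (simp add: adj)
qed


section \<open>The unitary group on Hermite generating functions\<close>

lemma group_generator_tendsto:
  assumes U: "unitary_group M U" and g: "(f, g) \<in> group_generator M U"
  shows "((\<lambda>t. \<integral>x. (cmod ((U t f x - f x) / of_real t - g x))\<^sup>2 \<partial>M) \<longlongrightarrow> 0) (at 0)"
proof -
  have "f \<in> L2 M" "g \<in> L2 M" using g by (auto simp: group_generator_def)
  moreover have "U t f \<in> L2 M" for t
    using U \<open>f \<in> L2 M\<close> by (auto simp: unitary_group_def unitary_operator_def)
  ultimately have "(\<lambda>x. (U t f x - f x) / of_real t - g x) \<in> L2 M" for t
    by (intro L2_diff L2_divide)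
  then show ?thesis
    using g by (subst tendsto_L2norm_0_iff[symmetric]) (auto simp: group_generator_def)
qed

definition coherent_flow :: "real ^ 'n \<Rightarrow> complex \<Rightarrow> real \<Rightarrow> real ^ 'n \<Rightarrow> complex" where
  "coherent_flow \<omega> z t = coherent \<omega> (exp (- \<i> * of_real t) * z)"

text \<open>The chain rule together with \<open>ou_coherent\<close> = - z d/dz
  \<open>coherent\<close>; this fixes the sign in exp (-i t). The time is complex here so that real
  derivative and difference quotients both come from one statement.\<close>

lemma coherent_flow_has_field_derivative:
  "((\<lambda>w. coherent \<omega> (exp (- \<i> * w) * z) x) has_field_derivative
    \<i> * ou_coherent \<omega> (exp (- \<i> * w) * z) x) (at w)"
  unfolding coherent_def ou_coherent_def
  by (rule derivative_eq_intros refl | simp add: power2_eq_square algebra_simps)+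

lemma coherent_flow_has_vector_derivative:
  "((\<lambda>t. coherent_flow \<omega> z t x) has_vector_derivative
    \<i> * ou_coherent \<omega> (exp (- \<i> * of_real t) * z) x) (at t)"
  unfolding coherent_flow_def
  by (rule has_vector_derivative_real_field[OF coherent_flow_has_field_derivative])

text \<open>The factor exp (-i t) keeps |z|, so the bound on the derivative does not depend on t and
  the mean value inequality bounds all difference quotients at once.\<close>

lemma coherent_flow_lipschitz:
  assumes \<omega>: "norm \<omega> = 1"
  shows "cmod (coherent_flow \<omega> z t x - coherent_flow \<omega> z u x)
    \<le> ((cmod z)\<^sup>2 + cmod z) * exp ((cmod z)\<^sup>2) * exp ((cmod z + 1) * norm x) * \<bar>t - u\<bar>"
proof -
  let ?B = "((cmod z)\<^sup>2 + cmod z) * exp ((cmod z)\<^sup>2) * exp ((cmod z + 1) * norm x)"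
  let ?D = "\<lambda>t. \<i> * ou_coherent \<omega> (exp (- \<i> * of_real t) * z) x"
  have "cmod (coherent_flow \<omega> z t x - coherent_flow \<omega> z u x) \<le> ?B * norm (t - u)"
  proof (rule differentiable_bound[of UNIV _ "\<lambda>t h. h *\<^sub>R ?D t"])
    show "((\<lambda>t. coherent_flow \<omega> z t x) has_derivative (\<lambda>h. h *\<^sub>R ?D t)) (at t within UNIV)" for t
      using coherent_flow_has_vector_derivative by (simp add: has_vector_derivative_def)
    fix t
    have b: "cmod (?D t) \<le> ?B"
      using norm_ou_coherent_le[OF \<omega>, of "exp (- \<i> * of_real t) * z" x]
      by (simp add: norm_mult norm_exp_eq_Re)
    show "onorm (\<lambda>h. h *\<^sub>R ?D t) \<le> ?B"
    proof (rule onorm_le)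
      fix h :: real
      have "\<bar>h\<bar> * cmod (?D t) \<le> \<bar>h\<bar> * ?B" by (intro mult_left_mono b) auto
      then show "norm (h *\<^sub>R ?D t) \<le> ?B * norm h"
        by (simp only: norm_scaleR real_norm_def mult.commute[of _ "\<bar>h\<bar>"])
    qed
  qed auto
  then show ?thesis by simp
qed

lemma coherent_flow_L2_derivative:
  fixes \<omega> :: "real ^ 'n"
  assumes \<omega>: "norm \<omega> = 1"
  shows "((\<lambda>d. \<integral>x. (cmod ((coherent_flow \<omega> z (t + d) x - coherent_flow \<omega> z t x) / of_real d
      - \<i> * ou_coherent \<omega> (exp (- \<i> * of_real t) * z) x))\<^sup>2 \<partial>gauss) \<longlongrightarrow> 0) (at 0)"
  unfolding tendsto_at_iff_sequentially
proof (intro allI impI)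
  fix X :: "nat \<Rightarrow> real"
  assume ne: "\<forall>i. X i \<in> UNIV - {0}" and X: "X \<longlonglongrightarrow> 0"
  let ?B = "\<lambda>x. ((cmod z)\<^sup>2 + cmod z) * exp ((cmod z)\<^sup>2) * exp ((cmod z + 1) * norm x)"
  let ?D = "\<lambda>x. \<i> * ou_coherent \<omega> (exp (- \<i> * of_real t) * z) x"
  let ?q = "\<lambda>n x. (coherent_flow \<omega> z (t + X n) x - coherent_flow \<omega> z t x) / of_real (X n)"
  have [measurable]: "coherent_flow \<omega> z t \<in> borel_measurable borel" for t
    unfolding coherent_flow_def by measurable
  have D: "cmod (?D x) \<le> ?B x" for x
    using norm_ou_coherent_le[OF \<omega>, of "exp (- \<i> * of_real t) * z" x]
    by (simp add: norm_mult norm_exp_eq_Re)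
  have q: "cmod (?q n x) \<le> ?B x" for n x
    using coherent_flow_lipschitz[OF \<omega>, of z "t + X n" x t] ne[rule_format, of n]
    by (simp add: norm_divide field_simps)
  have "(\<lambda>n. \<integral>x. (cmod (?q n x - ?D x))\<^sup>2 \<partial>gauss) \<longlonglongrightarrow> (\<integral>x. 0 \<partial>(gauss :: (real ^ 'n) measure))"
  proof (rule integral_dominated_convergence)
    \<comment> \<open>Quotient and derivative are both at most \<open>?B x\<close>, and |p - q|^2 <=
      2 |p|^2 + 2 |q|^2 gives the factor 4.\<close>
    show "integrable gauss (\<lambda>x :: real ^ 'n. 4 * (((cmod z)\<^sup>2 + cmod z) * exp ((cmod z)\<^sup>2))\<^sup>2 * exp ((2 * (cmod z + 1)) * norm x))"
      by (intro integrable_mult_right integrable_gauss_exp_norm)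
    show "AE x in gauss. norm ((cmod (?q n x - ?D x))\<^sup>2)
        \<le> 4 * (((cmod z)\<^sup>2 + cmod z) * exp ((cmod z)\<^sup>2))\<^sup>2 * exp ((2 * (cmod z + 1)) * norm x)" for n
    proof (intro AE_I2)
      fix x :: "real ^ 'n"
      have "(cmod (?q n x))\<^sup>2 \<le> (?B x)\<^sup>2" "(cmod (?D x))\<^sup>2 \<le> (?B x)\<^sup>2"
        using q D by (intro power_mono; simp)+
      then have "(cmod (?q n x - ?D x))\<^sup>2 \<le> 4 * (?B x)\<^sup>2"
        using cmod_diff_square_le[of "?q n x" "?D x"] by linarith
      also have "\<dots> = 4 * (((cmod z)\<^sup>2 + cmod z) * exp ((cmod z)\<^sup>2))\<^sup>2 * exp ((2 * (cmod z + 1)) * norm x)"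
        by (simp only: power_mult_distrib exp_double[symmetric] mult.assoc)
      finally show "norm ((cmod (?q n x - ?D x))\<^sup>2)
        \<le> 4 * (((cmod z)\<^sup>2 + cmod z) * exp ((cmod z)\<^sup>2))\<^sup>2 * exp ((2 * (cmod z + 1)) * norm x)" by simp
    qed
    show "AE x in gauss. (\<lambda>n. (cmod (?q n x - ?D x))\<^sup>2) \<longlonglongrightarrow> 0"
    proof (intro AE_I2)
      fix x
      have "filterlim (\<lambda>n. complex_of_real (X n)) (at 0) sequentially"
        using X ne tendsto_of_real[OF X, where ?'a = complex] by (intro filterlim_atI) auto
      from filterlim_compose[OF DERIV_D[OF coherent_flow_has_field_derivative[of \<omega> z x "of_real t"]] this]
      have "(\<lambda>n. ?q n x) \<longlonglongrightarrow> ?D x"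
        by (simp add: coherent_flow_def)
      from tendsto_power[OF tendsto_norm[OF tendsto_diff[OF this tendsto_const[of "?D x"]]], of 2]
      show "(\<lambda>n. (cmod (?q n x - ?D x))\<^sup>2) \<longlonglongrightarrow> 0" by simp
    qed
  qed measurable
  then show "((\<lambda>d. \<integral>x. (cmod ((coherent_flow \<omega> z (t + d) x - coherent_flow \<omega> z t x) / of_real d - ?D x))\<^sup>2 \<partial>gauss) \<circ> X)
      \<longlonglongrightarrow> 0"
    by (simp add: o_def)
qed

lemma integral_square_diff_le:
  assumes "f \<in> L2 M" "g \<in> L2 M"
  shows "(\<integral>x. (cmod (f x - g x))\<^sup>2 \<partial>M) \<le> 2 * (\<integral>x. (cmod (f x))\<^sup>2 \<partial>M) + 2 * (\<integral>x. (cmod (g x))\<^sup>2 \<partial>M)"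
proof -
  have i: "integrable M (\<lambda>x. (cmod (f x))\<^sup>2)" "integrable M (\<lambda>x. (cmod (g x))\<^sup>2)"
    "integrable M (\<lambda>x. (cmod (f x - g x))\<^sup>2)"
    using assms L2_diff[OF assms] by (simp_all add: L2_iff)
  then have "(\<integral>x. (cmod (f x - g x))\<^sup>2 \<partial>M) \<le> (\<integral>x. 2 * (cmod (f x))\<^sup>2 + 2 * (cmod (g x))\<^sup>2 \<partial>M)"
    by (intro integral_mono cmod_diff_square_le) auto
  then show ?thesis using i by simp
qed

lemma unitary_operator_integral_square:
  assumes "unitary_operator M T" "f \<in> L2 M"
  shows "(\<integral>x. (cmod (T f x))\<^sup>2 \<partial>M) = (\<integral>x. (cmod (f x))\<^sup>2 \<partial>M)"
proof -
  have "L2inner M (T f) (T f) = L2inner M f f" using assms by (auto simp: unitary_operator_def)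
  then show ?thesis by (simp add: L2inner_self)
qed

lemma L2inner_cong_AE:
  assumes "AE x in M. f x = f' x" "f \<in> L2 M" "f' \<in> L2 M" "g \<in> L2 M"
  shows "L2inner M f g = L2inner M f' g"
proof -
  note [measurable] = L2_measurable[OF assms(2)] L2_measurable[OF assms(3)] L2_measurable[OF assms(4)]
  show ?thesis
    unfolding L2inner_def by (rule integral_cong_AE) (use assms(1) in auto)
qed

text \<open>
  The curve \<open>coherent_flow\<close> solves the same Cauchy problem as \<open>U t (coherent \<omega> z)\<close>, so its inner product
  with \<open>U t \<phi>\<close> has derivative \<open>0\<close>.
\<close>

lemma L2inner_coherent_flow:
  fixes L :: "(real ^ 'n) op_graph"
  assumes L: "ou_self_adjoint L" and U: "stone_group gauss L U" and \<phi>: "\<phi> \<in> L2 gauss" and \<omega>: "norm \<omega> = 1"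
  shows "L2inner gauss (U t \<phi>) (coherent_flow \<omega> z t) = L2inner gauss (U 0 \<phi>) (coherent \<omega> z)"
proof -
  have ug: "unitary_group gauss U" using U by (simp add: stone_group_def)
  have uo: "unitary_operator gauss (U t)" for t using ug by (simp add: unitary_group_def)
  have UL2: "U t f \<in> L2 gauss" if "f \<in> L2 gauss" for t f
    using uo that by (auto simp: unitary_operator_def)
  have vL2: "coherent_flow \<omega> z t \<in> L2 gauss" for t
    unfolding coherent_flow_def by (rule coherent_L2[OF \<omega>])
  define k where "k = (\<lambda>t. L2inner gauss (U t \<phi>) (coherent_flow \<omega> z t))"
  have "(k has_vector_derivative 0) (at t)" for t
  proof -
    let ?v = "coherent_flow \<omega> z"
    let ?D = "\<lambda>x. \<i> * ou_coherent \<omega> (exp (- \<i> * of_real t) * z) x"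
    \<comment> \<open>\<open>?p\<close> is the error in differentiating the explicit curve at t,
      \<open>?r\<close> the error in differentiating the group orbit of its value at t. Both have
      the same derivative \<open>?D\<close>, because that value lies in the domain.\<close>
    let ?p = "\<lambda>d x. (?v (t + d) x - ?v t x) / of_real d - ?D x"
    let ?r = "\<lambda>d x. (U d (?v t) x - ?v t x) / of_real d - ?D x"
    define N where "N = (\<lambda>f. \<integral>x. (cmod (f x))\<^sup>2 \<partial>(gauss :: (real ^ 'n) measure))"
    have DL2: "?D \<in> L2 gauss" by (intro L2_mult_left ou_coherent_L2 \<omega>)
    have p: "((\<lambda>d. N (?p d)) \<longlongrightarrow> 0) (at 0)"
      unfolding N_def by (rule coherent_flow_L2_derivative[OF \<omega>])
    have "(?v t, ?D) \<in> group_generator gauss U"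
      using U coherent_in_ou[OF L \<omega>, of "exp (- \<i> * of_real t) * z"]
      by (auto simp: stone_group_def coherent_flow_def)
    then have r: "((\<lambda>d. N (?r d)) \<longlongrightarrow> 0) (at 0)"
      unfolding N_def by (rule group_generator_tendsto[OF ug])
    have pL2: "?p d \<in> L2 gauss" and rL2: "?r d \<in> L2 gauss" for d
      by (intro L2_diff L2_divide vL2 UL2 DL2)+
    have quot: "cmod ((k (t + d) - k t) / of_real d) \<le> sqrt (N \<phi>) * sqrt (2 * N (?p d) + 2 * N (?r d))"
      if "d \<noteq> 0" for d
    proof -
      \<comment> \<open>Unitarity of \<open>U d\<close> moves \<open>k t\<close> to time t + d. Both
        inner products then share their first argument, so \<open>U t \<phi>\<close>, which may lie
        outside the domain, is never differentiated.\<close>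
      have "AE x in gauss. U (t + d) \<phi> x = U d (U t \<phi>) x"
        using ug \<phi> unfolding unitary_group_def by (metis add.commute)
      then have "L2inner gauss (U (t + d) \<phi>) (U d (?v t)) = L2inner gauss (U d (U t \<phi>)) (U d (?v t))"
        by (rule L2inner_cong_AE) (intro UL2 \<phi> vL2)+
      also have "\<dots> = k t"
        using uo[of d] UL2[OF \<phi>] vL2 by (auto simp: unitary_operator_def k_def)
      finally have kt: "k t = L2inner gauss (U (t + d) \<phi>) (U d (?v t))" ..
      \<comment> \<open>In \<open>?p d - ?r d\<close> the terms \<open>?v t\<close> and
        \<open>?D\<close> cancel, leaving the quotient of \<open>?v (t + d)\<close> minus
        \<open>U d (?v t)\<close> by d.\<close>
      have kd: "(k (t + d) - k t) / of_real d = L2inner gauss (U (t + d) \<phi>) (\<lambda>x. ?p d x - ?r d x)"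
      proof -
        have eq: "cnj (?p d x - ?r d x) = (cnj (?v (t + d) x) - cnj (U d (?v t) x)) / of_real d" for x
          by (simp add: diff_divide_distrib)
        have ktd: "k (t + d) = L2inner gauss (U (t + d) \<phi>) (?v (t + d))" by (simp add: k_def)
        have i: "integrable gauss (\<lambda>x. U (t + d) \<phi> x * cnj (?v (t + d) x))"
          "integrable gauss (\<lambda>x. U (t + d) \<phi> x * cnj (U d (?v t) x))"
          by (intro L2_mult_integrable UL2 vL2 \<phi>)+
        show ?thesis
          unfolding kt ktd L2inner_def eq times_divide_eq_right right_diff_distrib
          using i by simp
      qed
      have cs: "cmod (L2inner gauss (U (t + d) \<phi>) (\<lambda>x. ?p d x - ?r d x)) \<le> sqrt (N (U (t + d) \<phi>)) * sqrt (N (\<lambda>x. ?p d x - ?r d x))"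
        unfolding N_def by (intro L2inner_cauchy_schwarz UL2 \<phi> L2_diff pL2 rL2)
      have Nu: "N (U (t + d) \<phi>) = N \<phi>"
        unfolding N_def by (rule unitary_operator_integral_square[OF uo \<phi>])
      have "N (\<lambda>x. ?p d x - ?r d x) \<le> 2 * N (?p d) + 2 * N (?r d)"
        unfolding N_def by (rule integral_square_diff_le[OF pL2 rL2])
      then have "sqrt (N \<phi>) * sqrt (N (\<lambda>x. ?p d x - ?r d x)) \<le> sqrt (N \<phi>) * sqrt (2 * N (?p d) + 2 * N (?r d))"
        by (intro mult_left_mono real_sqrt_le_mono) (auto simp: N_def)
      from order_trans[OF cs[unfolded Nu] this] show ?thesis unfolding kd .
    qed
    have "((\<lambda>d. sqrt (N \<phi>) * sqrt (2 * N (?p d) + 2 * N (?r d))) \<longlongrightarrow> sqrt (N \<phi>) * sqrt (2 * 0 + 2 * 0)) (at 0)"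
      by (intro tendsto_intros p r)
    then have "((\<lambda>d. sqrt (N \<phi>) * sqrt (2 * N (?p d) + 2 * N (?r d))) \<longlongrightarrow> 0) (at 0)" by simp
    then have "((\<lambda>d. (k (t + d) - k t) / of_real d) \<longlongrightarrow> 0) (at 0)"
      by (rule Lim_null_comparison[rotated]) (use quot in \<open>auto simp: eventually_at_filter\<close>)
    then have "((\<lambda>d. norm ((k (t + d) - k t) / of_real d)) \<longlongrightarrow> 0) (at 0)"
      by (rule tendsto_norm_zero)
    then show ?thesis
      by (simp add: has_vector_derivative_def has_derivative_at norm_divide)
  qed
  then have "(k has_derivative (\<lambda>h. 0)) (at t within UNIV)" for t
    by (simp add: has_vector_derivative_def)
  then have "k t = k 0" by (intro has_derivative_zero_unique[of UNIV k]) auto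
  then show ?thesis by (simp add: k_def coherent_flow_def)
qed


section \<open>The integral transform against Hermite generating functions\<close>

text \<open>The function F of the overview. The pairing is bilinear, so that it is holomorphic in z;
  in terms of \<open>L2inner\<close> it is the inner product with
  \<open>coherent \<omega> (cnj z)\<close>.\<close>

definition transform :: "(real ^ 'n \<Rightarrow> complex) \<Rightarrow> real ^ 'n \<Rightarrow> complex \<Rightarrow> complex" where
  "transform \<phi> \<omega> z = (\<integral>x. \<phi> x * coherent \<omega> z x \<partial>gauss)"

lemma cnj_coherent: "cnj (coherent \<omega> z x) = coherent \<omega> (cnj z) x"
  by (simp add: coherent_def exp_cnj)

text \<open>\<open>L2inner_coherent_flow\<close> at \<open>cnj z\<close>: conjugation turns exp (-i
  t) into exp (i t).\<close>

lemma transform_flow: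
  fixes L :: "(real ^ 'n) op_graph"
  assumes "ou_self_adjoint L" "stone_group gauss L U" "\<phi> \<in> L2 gauss" "norm \<omega> = 1"
  shows "transform (U t \<phi>) \<omega> (exp (\<i> * of_real t) * z) = transform (U 0 \<phi>) \<omega> z"
  using L2inner_coherent_flow[OF assms, of t "cnj z"]
  by (simp add: transform_def L2inner_def coherent_flow_def cnj_coherent exp_cnj)

lemma transform_holomorphic:
  assumes \<phi>: "\<phi> \<in> L2 gauss" and \<omega>: "norm \<omega> = 1"
  shows "transform \<phi> \<omega> holomorphic_on UNIV"
proof -
  have [measurable]: "\<phi> \<in> borel_measurable borel" using \<phi> by (simp add: L2_iff)
  have int: "integrable gauss (\<lambda>x. exp (c * \<bar>\<omega> \<bullet> x\<bar>) * norm (\<phi> x))" for c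
  proof (rule Bochner_Integration.integrable_bound)
    have "(\<lambda>x. complex_of_real (exp (\<bar>c\<bar> * norm x))) \<in> L2 gauss"
      by (rule L2_gauss_exp_growth[of _ 1 "\<bar>c\<bar>"]) auto
    from L2_mult_integrable(1)[OF this \<phi>]
    show "integrable gauss (\<lambda>x. exp (\<bar>c\<bar> * norm x) * norm (\<phi> x))" by simp
    show "AE x in gauss. norm (exp (c * \<bar>\<omega> \<bullet> x\<bar>) * norm (\<phi> x)) \<le> norm (exp (\<bar>c\<bar> * norm x) * norm (\<phi> x))"
    proof (intro AE_I2)
      fix x
      have "c * \<bar>\<omega> \<bullet> x\<bar> \<le> \<bar>c\<bar> * norm x"
        using norm_inner_unit_le[OF \<omega>, of x] by (intro mult_mono) auto
      then show "norm (exp (c * \<bar>\<omega> \<bullet> x\<bar>) * norm (\<phi> x)) \<le> norm (exp (\<bar>c\<bar> * norm x) * norm (\<phi> x))"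
        by (simp add: mult_right_mono)
    qed
  qed simp
  have "(\<lambda>z. exp (- z\<^sup>2 / 2) * (\<integral>x. \<phi> x * exp (z * of_real (\<omega> \<bullet> x)) \<partial>gauss)) holomorphic_on UNIV"
    by (intro holomorphic_intros integral_exp_holomorphic[OF _ _ int]) auto
  moreover have "transform \<phi> \<omega> = (\<lambda>z. exp (- z\<^sup>2 / 2) * (\<integral>x. \<phi> x * exp (z * of_real (\<omega> \<bullet> x)) \<partial>gauss))"
  proof
    fix z
    have "coherent \<omega> z x = exp (- z\<^sup>2 / 2) * exp (z * of_real (\<omega> \<bullet> x))" for x
      unfolding coherent_def exp_add[symmetric] by simp
    then show "transform \<phi> \<omega> z = exp (- z\<^sup>2 / 2) * (\<integral>x. \<phi> x * exp (z * of_real (\<omega> \<bullet> x)) \<partial>gauss)"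
      unfolding transform_def integral_mult_right_zero[symmetric] by (simp only: mult.left_commute)
  qed
  ultimately show ?thesis by (simp only:)
qed

section \<open>Gaussian averages of square integrable functions along a line\<close>

definition gaussian_average :: "(real ^ 'n \<Rightarrow> real) \<Rightarrow> real \<Rightarrow> real ^ 'n \<Rightarrow> real \<Rightarrow> real" where
  "gaussian_average h l \<omega> p = (\<integral>x. h x * exp (- l * (norm (x - p *\<^sub>R \<omega>))\<^sup>2) \<partial>lborel)"

context
  fixes h :: "real ^ 'n \<Rightarrow> real" and l :: real and \<omega> :: "real ^ 'n"
  assumes h_measurable [measurable]: "h \<in> borel_measurable borel" and h_nonneg: "\<And>x. 0 \<le> h x"
    and h_square: "integrable lborel (\<lambda>x. (h x)\<^sup>2)" and l: "l > 0" and \<omega>: "norm \<omega> = 1"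
begin

lemma gaussian_average_square_integrable:
  "integrable lborel (\<lambda>x. (h x)\<^sup>2 * exp (- l * (norm (x - p *\<^sub>R \<omega>))\<^sup>2))"
  by (rule Bochner_Integration.integrable_bound[OF h_square]) (use l in \<open>auto simp: mult_left_le\<close>)

text \<open>Pointwise h <= e + h^2 / e. The first term contributes e times a fixed mass, the second
  sees the square integrability of h; the free e serves the limit as well as the uniform
  bound.\<close>

lemma gaussian_average_le:
  assumes e: "e > 0"
  shows "gaussian_average h l \<omega> p \<le> e * (\<integral>x. exp (- l * (norm x)\<^sup>2) \<partial>(lborel :: (real ^ 'n) measure))
    + (\<integral>x. (h x)\<^sup>2 * exp (- l * (norm (x - p *\<^sub>R \<omega>))\<^sup>2) \<partial>lborel) / e"
proof -
  let ?g = "\<lambda>x. exp (- l * (norm (x - p *\<^sub>R \<omega>))\<^sup>2)"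
  have le: "h x \<le> e + (h x)\<^sup>2 / e" for x
  proof -
    have "0 \<le> (h x - e / 2)\<^sup>2" by simp
    then have "e * h x \<le> e * e / 4 + (h x)\<^sup>2"
      by (simp add: power2_eq_square algebra_simps)
    moreover have "0 \<le> e * e" by simp
    ultimately have "e * h x \<le> e * e + (h x)\<^sup>2" by linarith
    then show ?thesis using e by (simp add: field_simps)
  qed
  have "gaussian_average h l \<omega> p \<le> (\<integral>x. e * ?g x + (h x)\<^sup>2 * ?g x / e \<partial>lborel)"
    unfolding gaussian_average_def
  proof (rule integral_mono')
    show "integrable lborel (\<lambda>x. e * ?g x + (h x)\<^sup>2 * ?g x / e)"
      by (intro Bochner_Integration.integrable_add integrable_mult_right integrable_divide
          integrable_gaussian_centered gaussian_average_square_integrable l)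
    show "h x * ?g x \<le> e * ?g x + (h x)\<^sup>2 * ?g x / e" for x
      using mult_right_mono[OF le[of x], of "?g x"] by (simp add: distrib_right)
    show "0 \<le> e * ?g x + (h x)\<^sup>2 * ?g x / e" for x using e by simp
  qed
  also have "\<dots> = e * (\<integral>x. ?g x \<partial>lborel) + (\<integral>x. (h x)\<^sup>2 * ?g x \<partial>lborel) / e"
    using integrable_gaussian_centered[OF l, of "p *\<^sub>R \<omega>"] gaussian_average_square_integrable[of p] by simp
  also have "(\<integral>x. ?g x \<partial>lborel) = (\<integral>x. exp (- l * (norm x)\<^sup>2) \<partial>(lborel :: (real ^ 'n) measure))"
    by (rule integral_gaussian_centered)
  finally show ?thesis .
qed

lemma gaussian_average_nonneg: "0 \<le> gaussian_average h l \<omega> p"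
  unfolding gaussian_average_def using h_nonneg by (intro integral_nonneg_AE) auto

lemma gaussian_average_bounded: "\<exists>D. \<forall>p. gaussian_average h l \<omega> p \<le> D"
proof (intro exI allI)
  fix p
  have "(\<integral>x. (h x)\<^sup>2 * exp (- l * (norm (x - p *\<^sub>R \<omega>))\<^sup>2) \<partial>lborel) \<le> (\<integral>x. (h x)\<^sup>2 \<partial>lborel)"
    using l by (intro integral_mono gaussian_average_square_integrable h_square) (auto simp: mult_left_le)
  then show "gaussian_average h l \<omega> p
      \<le> (\<integral>x. exp (- l * (norm x)\<^sup>2) \<partial>(lborel :: (real ^ 'n) measure)) + (\<integral>x. (h x)\<^sup>2 \<partial>lborel)"
    using gaussian_average_le[of 1 p] by simp
qed

text \<open>Source of the decay along a line: the centre escapes to infinity, so the Gaussian tends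
  to 0 pointwise, while the integrable h^2 dominates.\<close>

lemma gaussian_average_tendsto:
  assumes c: "c \<noteq> 0"
  shows "((\<lambda>r. gaussian_average h l \<omega> (c * r)) \<longlongrightarrow> 0) at_top"
proof -
  define J where "J = (\<lambda>r. \<integral>x. (h x)\<^sup>2 * exp (- l * (norm (x - (c * r) *\<^sub>R \<omega>))\<^sup>2) \<partial>lborel)"
  define m where "m = (\<integral>x. exp (- l * (norm x)\<^sup>2) \<partial>(lborel :: (real ^ 'n) measure))"
  have m: "m \<ge> 0" by (simp add: m_def)
  have "(J \<longlongrightarrow> (\<integral>x. 0 \<partial>(lborel :: (real ^ 'n) measure))) at_top"
    unfolding J_def
  proof (rule integral_dominated_convergence_at_top)
    show "integrable lborel (\<lambda>x. (h x)\<^sup>2)" by (rule h_square)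
    show "\<forall>\<^sub>F r in at_top. AE x in lborel. norm ((h x)\<^sup>2 * exp (- l * (norm (x - (c * r) *\<^sub>R \<omega>))\<^sup>2)) \<le> (h x)\<^sup>2"
      using l by (intro always_eventually allI AE_I2) (auto simp: mult_left_le)
    show "AE x in lborel. ((\<lambda>r. (h x)\<^sup>2 * exp (- l * (norm (x - (c * r) *\<^sub>R \<omega>))\<^sup>2)) \<longlongrightarrow> 0) at_top"
    proof (intro AE_I2 tendsto_mult_right_zero)
      fix x :: "real ^ 'n"
      have "filterlim (\<lambda>r. \<bar>c\<bar> * r - norm x) at_top at_top"
        using c by real_asymp
      moreover have "eventually (\<lambda>r. \<bar>c\<bar> * r - norm x \<le> norm (x - (c * r) *\<^sub>R \<omega>)) at_top"
        using eventually_ge_at_top[of 0]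
      proof eventually_elim
        case (elim r)
        have "norm ((c * r) *\<^sub>R \<omega>) - norm x \<le> norm ((c * r) *\<^sub>R \<omega> - x)" by (rule norm_triangle_ineq2)
        then show ?case using elim \<omega> by (simp add: abs_mult norm_minus_commute)
      qed
      ultimately have "filterlim (\<lambda>r. norm (x - (c * r) *\<^sub>R \<omega>)) at_top at_top"
        by (rule filterlim_at_top_mono)
      then have "filterlim (\<lambda>r. l * (norm (x - (c * r) *\<^sub>R \<omega>))\<^sup>2) at_top at_top"
        using l by (intro filterlim_tendsto_pos_mult_at_top[OF tendsto_const] filterlim_pow_at_top) auto
      then have "filterlim (\<lambda>r. - l * (norm (x - (c * r) *\<^sub>R \<omega>))\<^sup>2) at_bot at_top"
        by (simp add: filterlim_uminus_at_top)
      then show "((\<lambda>r. exp (- l * (norm (x - (c * r) *\<^sub>R \<omega>))\<^sup>2)) \<longlongrightarrow> 0) at_top"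
        by (rule filterlim_compose[OF exp_at_bot])
    qed
  qed auto
  then have J: "(J \<longlongrightarrow> 0) at_top" by simp
  show ?thesis
  proof (rule tendstoI)
    fix \<eta> :: real assume \<eta>: "\<eta> > 0"
    \<comment> \<open>First e makes the mass term less than \<eta> / 2, then r is taken so large
      that J r / e is less than \<eta> / 2; m + 1 also covers m = 0.\<close>
    define e where "e = \<eta> / (2 * (m + 1))"
    have e: "e > 0" "e * m < \<eta> / 2" using \<eta> m by (auto simp: e_def field_simps)
    have "eventually (\<lambda>r. J r < e * (\<eta> / 2)) at_top"
      using J e \<eta> by (intro order_tendstoD) auto
    then show "\<forall>\<^sub>F r in at_top. dist (gaussian_average h l \<omega> (c * r)) 0 < \<eta>"
    proof eventually_elim
      case (elim r)
      have "gaussian_average h l \<omega> (c * r) \<le> e * m + J r / e"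
        using gaussian_average_le[OF e(1)] by (simp add: J_def m_def)
      moreover have "J r / e < \<eta> / 2" using elim e by (simp add: field_simps)
      ultimately have "gaussian_average h l \<omega> (c * r) < \<eta>" using e by linarith
      then show ?case using gaussian_average_nonneg[of "c * r"] by (simp add: dist_real_def)
    qed
  qed
qed

end

text \<open>Half-angle formulas: they translate exponents |w| + Re w and |w| - Re w with w = z^2
  into squares of the real and imaginary part of z.\<close>

lemma cmod_square_Re: "(Re z)\<^sup>2 = (cmod (z\<^sup>2) + Re (z\<^sup>2)) / 2"
  and cmod_square_Im: "(Im z)\<^sup>2 = (cmod (z\<^sup>2) - Re (z\<^sup>2)) / 2"
  unfolding norm_power cmod_power2 by (simp_all add: power2_eq_square)

text \<open>Completing the square in \<open>exp (- l * \<bar>x\<bar>\<^sup>2 + Re z * (\<omega> \<bullet> x))\<close> with \<open>l = a + 1 / 4\<close>.\<close>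

lemma transform_bound:
  fixes \<phi> :: "real ^ 'n \<Rightarrow> complex" and a :: real
  assumes [measurable]: "\<phi> \<in> borel_measurable borel" and a: "a > 0"
    and w: "(\<lambda>x. complex_of_real (exp (a * (norm x)\<^sup>2)) * \<phi> x) \<in> L2 gauss"
  obtains h :: "real ^ 'n \<Rightarrow> real" where
    "h \<in> borel_measurable borel" "\<And>x. 0 \<le> h x" "integrable lborel (\<lambda>x. (h x)\<^sup>2)"
    "\<And>\<omega> z. norm \<omega> = 1 \<Longrightarrow> cmod (transform \<phi> \<omega> z)
      \<le> exp ((cmod (z\<^sup>2) / (1 + 4 * a) - (1 - 1 / (1 + 4 * a)) * Re (z\<^sup>2)) / 2)
        * gaussian_average h (a + 1 / 4) \<omega> (2 * Re z / (1 + 4 * a))"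
proof
  \<comment> \<open>Half of the Gaussian density goes into h, which makes the Lebesgue integral of
    h^2 equal to the squared weighted norm of \<phi>. The kernel keeps exp (- (a + 1/4)
    |x|^2).\<close>
  define h where "h = (\<lambda>x. exp ((a - 1 / 4) * (norm x)\<^sup>2) * cmod (\<phi> x))"
  show [measurable]: "h \<in> borel_measurable borel" unfolding h_def by measurable
  show "0 \<le> h x" for x by (simp add: h_def)
  have sq: "(h x)\<^sup>2 = exp (- (norm x)\<^sup>2 / 2) * (cmod (complex_of_real (exp (a * (norm x)\<^sup>2)) * \<phi> x))\<^sup>2" for x
    by (simp add: h_def norm_mult power_mult_distrib exp_double[symmetric] flip: exp_add)
      (simp add: field_simps)
  show "integrable lborel (\<lambda>x. (h x)\<^sup>2)"
    using w unfolding sq by (simp add: L2_iff integrable_gauss)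
  fix \<omega> :: "real ^ 'n" and z assume \<omega>: "norm \<omega> = 1"
  \<comment> \<open>The vertex Re z / (2 l) for l = a + 1/4.\<close>
  define p where "p = 2 * Re z / (1 + 4 * a)"
  let ?E = "exp ((cmod (z\<^sup>2) / (1 + 4 * a) - (1 - 1 / (1 + 4 * a)) * Re (z\<^sup>2)) / 2)"
  have eq: "cmod (exp (- (norm x)\<^sup>2 / 2) *\<^sub>R (\<phi> x * coherent \<omega> z x))
      = ?E * (h x * exp (- (a + 1 / 4) * (norm (x - p *\<^sub>R \<omega>))\<^sup>2))" for x
  proof -
    have sq_diff: "(norm (x - p *\<^sub>R \<omega>))\<^sup>2 = (norm x)\<^sup>2 - 2 * p * (\<omega> \<bullet> x) + p\<^sup>2"
      using \<omega> unfolding power2_norm_eq_inner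
      by (simp add: inner_diff_left inner_diff_right inner_commute[of x \<omega>] norm_eq_1 power2_eq_square algebra_simps)
    have "(a + 1 / 4) * (norm (x - p *\<^sub>R \<omega>))\<^sup>2
        = (a + 1 / 4) * (norm x)\<^sup>2 - (2 * (a + 1 / 4) * p) * (\<omega> \<bullet> x) + (a + 1 / 4) * p\<^sup>2"
      unfolding sq_diff by (simp add: algebra_simps)
    moreover have "2 * (a + 1 / 4) * p = Re z" "(a + 1 / 4) * p\<^sup>2 = (Re z)\<^sup>2 / (1 + 4 * a)"
      using a by (simp_all add: p_def power_divide divide_simps) (simp_all add: power2_eq_square algebra_simps)
    ultimately have "(a + 1 / 4) * (norm (x - p *\<^sub>R \<omega>))\<^sup>2
        = (a + 1 / 4) * (norm x)\<^sup>2 - Re z * (\<omega> \<bullet> x) + (Re z)\<^sup>2 / (1 + 4 * a)"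
      by simp
    moreover have "(cmod (z\<^sup>2) / (1 + 4 * a) - (1 - 1 / (1 + 4 * a)) * Re (z\<^sup>2)) / 2 = (Re z)\<^sup>2 / (1 + 4 * a) - Re (z\<^sup>2) / 2"
      unfolding cmod_square_Re by (simp add: add_divide_distrib diff_divide_distrib left_diff_distrib)
    ultimately have "- (norm x)\<^sup>2 / 2 + (Re z * (\<omega> \<bullet> x) - Re (z\<^sup>2) / 2)
        = (cmod (z\<^sup>2) / (1 + 4 * a) - (1 - 1 / (1 + 4 * a)) * Re (z\<^sup>2)) / 2
          + ((a - 1 / 4) * (norm x)\<^sup>2 + - (a + 1 / 4) * (norm (x - p *\<^sub>R \<omega>))\<^sup>2)"
      by (simp add: algebra_simps)
    from arg_cong[OF this, of exp] show ?thesis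
      unfolding exp_add by (simp add: h_def coherent_def norm_mult norm_exp_eq_Re mult_ac)
  qed
  have "cmod (transform \<phi> \<omega> z) \<le> (\<integral>x. cmod (exp (- (norm x)\<^sup>2 / 2) *\<^sub>R (\<phi> x * coherent \<omega> z x)) \<partial>lborel)"
  proof -
    have "transform \<phi> \<omega> z = (\<integral>x. exp (- (norm x)\<^sup>2 / 2) *\<^sub>R (\<phi> x * coherent \<omega> z x) \<partial>lborel)"
      unfolding transform_def by (rule integral_gauss) measurable
    then show ?thesis by (simp only: integral_norm_bound)
  qed
  also have "\<dots> = ?E * gaussian_average h (a + 1 / 4) \<omega> p"
    unfolding eq gaussian_average_def by simp
  finally show "cmod (transform \<phi> \<omega> z) \<le> ?E * gaussian_average h (a + 1 / 4) \<omega> (2 * Re z / (1 + 4 * a))"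
    by (simp add: p_def)
qed

section \<open>Vanishing of the transform\<close>

text \<open>
  In the variable \<open>w = z\<^sup>2\<close> the two bounds on the exponent are \<open>(r1 * \<bar>w\<bar> + Re (c1 * w)) / 2\<close> and
  \<open>(r2 * \<bar>w\<bar> + Re (c2 * w)) / 2\<close>. The discs with centres \<open>c1, c2\<close> and radii \<open>r1, r2\<close> touch exactly when
  \<open>16 * a * b * (sin s)\<^sup>2 = 1\<close>; dividing by \<open>exp (q * w / 2)\<close> for the point of contact \<open>q\<close>, and rotating,
  turns the bounds into those of \<open>entire_eq_0_of_cross_bounds\<close>.
\<close>

lemma transform_eq_0:
  fixes \<phi> \<psi> :: "real ^ 'n \<Rightarrow> complex" and a b s :: real
  assumes \<phi>: "\<phi> \<in> L2 gauss" and \<psi>: "\<psi> \<in> L2 gauss" and a: "a > 0" and b: "b > 0"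
    and w\<phi>: "(\<lambda>x. complex_of_real (exp (a * (norm x)\<^sup>2)) * \<phi> x) \<in> L2 gauss"
    and w\<psi>: "(\<lambda>x. complex_of_real (exp (b * (norm x)\<^sup>2)) * \<psi> x) \<in> L2 gauss"
    and sin: "16 * a * b * (sin s)\<^sup>2 = 1" and \<omega>: "norm \<omega> = 1"
    and flow: "\<And>z. transform \<psi> \<omega> (exp (\<i> * of_real s) * z) = transform \<phi> \<omega> z"
  shows "transform \<phi> \<omega> z = 0"
proof -
  define r1 where "r1 = 1 / (1 + 4 * a)"
  define r2 where "r2 = 1 / (1 + 4 * b)"
  define c1 where "c1 = - complex_of_real (1 - r1)"
  \<comment> \<open>The factor exp (2 i s) appears because the bound for \<psi> is used at exp (i s)
    z and squared.\<close>
  define c2 where "c2 = - complex_of_real (1 - r2) * exp (2 * \<i> * of_real s)"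
  have r1: "0 < r1" "r1 < 1" and r2: "0 < r2" "r2 < 1" using a b by (auto simp: r1_def r2_def)
  have [measurable]: "\<phi> \<in> borel_measurable borel" "\<psi> \<in> borel_measurable borel"
    using \<phi> \<psi> by (simp_all add: L2_iff)
  obtain h1 where h1: "h1 \<in> borel_measurable borel" "\<And>x. 0 \<le> h1 x" "integrable lborel (\<lambda>x. (h1 x)\<^sup>2)"
    and bd1: "\<And>\<omega> z. norm \<omega> = 1 \<Longrightarrow> cmod (transform \<phi> \<omega> z)
      \<le> exp ((cmod (z\<^sup>2) / (1 + 4 * a) - (1 - 1 / (1 + 4 * a)) * Re (z\<^sup>2)) / 2)
        * gaussian_average h1 (a + 1 / 4) \<omega> (2 * Re z / (1 + 4 * a))"
    using transform_bound[OF _ a w\<phi>] by auto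
  obtain h2 where h2: "h2 \<in> borel_measurable borel" "\<And>x. 0 \<le> h2 x" "integrable lborel (\<lambda>x. (h2 x)\<^sup>2)"
    and bd2: "\<And>\<omega> z. norm \<omega> = 1 \<Longrightarrow> cmod (transform \<psi> \<omega> z)
      \<le> exp ((cmod (z\<^sup>2) / (1 + 4 * b) - (1 - 1 / (1 + 4 * b)) * Re (z\<^sup>2)) / 2)
        * gaussian_average h2 (b + 1 / 4) \<omega> (2 * Re z / (1 + 4 * b))"
    using transform_bound[OF _ b w\<psi>] by auto
  define N1 where "N1 = gaussian_average h1 (a + 1 / 4) \<omega>"
  define N2 where "N2 = gaussian_average h2 (b + 1 / 4) \<omega>"
  have a4: "a + 1 / 4 > 0" and b4: "b + 1 / 4 > 0" using a b by auto
  obtain D1 where D1: "\<And>p. N1 p \<le> D1" using gaussian_average_bounded[OF h1 a4 \<omega>] unfolding N1_def by blast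
  obtain D2 where D2: "\<And>p. N2 p \<le> D2" using gaussian_average_bounded[OF h2 b4 \<omega>] unfolding N2_def by blast
  have F1: "cmod (transform \<phi> \<omega> z) \<le> exp ((r1 * cmod (z\<^sup>2) + Re (c1 * z\<^sup>2)) / 2) * N1 (2 * r1 * Re z)" for z
  proof -
    have "r1 * cmod (z\<^sup>2) + Re (c1 * z\<^sup>2) = cmod (z\<^sup>2) / (1 + 4 * a) - (1 - 1 / (1 + 4 * a)) * Re (z\<^sup>2)"
      by (simp add: r1_def c1_def algebra_simps)
    moreover have "2 * r1 * Re z = 2 * Re z / (1 + 4 * a)" by (simp add: r1_def)
    ultimately show ?thesis using bd1[OF \<omega>, of z] by (simp only: N1_def)
  qed
  have F2: "cmod (transform \<phi> \<omega> z) \<le> exp ((r2 * cmod (z\<^sup>2) + Re (c2 * z\<^sup>2)) / 2) * D2" for z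
  proof -
    let ?u = "exp (\<i> * of_real s) * z"
    have u: "?u\<^sup>2 = exp (2 * \<i> * of_real s) * z\<^sup>2"
      by (simp add: power_mult_distrib exp_double[symmetric] mult.assoc)
    have cm: "cmod (?u\<^sup>2) = cmod (z\<^sup>2)" unfolding u by (simp add: norm_mult norm_exp_eq_Re)
    have cr: "Re (c2 * z\<^sup>2) = - (1 - r2) * Re (?u\<^sup>2)"
      unfolding u by (simp add: c2_def algebra_simps)
    have "r2 * cmod (z\<^sup>2) + Re (c2 * z\<^sup>2) = cmod (?u\<^sup>2) / (1 + 4 * b) - (1 - 1 / (1 + 4 * b)) * Re (?u\<^sup>2)"
      unfolding cr cm by (simp add: r2_def algebra_simps)
    moreover have "2 * r2 * Re ?u = 2 * Re ?u / (1 + 4 * b)" by (simp add: r2_def)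
    ultimately have "cmod (transform \<phi> \<omega> z) \<le> exp ((r2 * cmod (z\<^sup>2) + Re (c2 * z\<^sup>2)) / 2) * N2 (2 * r2 * Re ?u)"
      using bd2[OF \<omega>, of ?u] unfolding flow by (simp only: N2_def)
    also have "\<dots> \<le> exp ((r2 * cmod (z\<^sup>2) + Re (c2 * z\<^sup>2)) / 2) * D2"
      by (intro mult_left_mono D2) auto
    finally show ?thesis .
  qed
  \<comment> \<open>The squared distance is (r1 - r2)^2 + 4 (1 - r1) (1 - r2) sin^2 s. As 1 - r1 = 4
    a r1 and 1 - r2 = 4 b r2, the hypothesis turns the last term into 4 r1 r2.\<close>
  have dist: "cmod (c2 - c1) = r1 + r2"
  proof -
    have "(cmod (c2 - c1))\<^sup>2 = (1 - r1)\<^sup>2 + (1 - r2)\<^sup>2 * ((cos (2 * s))\<^sup>2 + (sin (2 * s))\<^sup>2) - 2 * (1 - r1) * (1 - r2) * cos (2 * s)"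
    proof -
      have "((1 - r1) - (1 - r2) * C)\<^sup>2 + (- (1 - r2) * S)\<^sup>2
          = (1 - r1)\<^sup>2 + (1 - r2)\<^sup>2 * (C\<^sup>2 + S\<^sup>2) - 2 * (1 - r1) * (1 - r2) * C" for C S
        by (simp add: power2_eq_square algebra_simps)
      moreover have "Re (c2 - c1) = (1 - r1) - (1 - r2) * cos (2 * s)" "Im (c2 - c1) = - (1 - r2) * sin (2 * s)"
        by (simp_all add: c1_def c2_def Re_exp Im_exp algebra_simps)
      ultimately show ?thesis unfolding cmod_power2 by (simp only:)
    qed
    also have "\<dots> = (1 - r1)\<^sup>2 + (1 - r2)\<^sup>2 - 2 * ((1 - r1) * (1 - r2)) + 4 * ((1 - r1) * (1 - r2) * (sin s)\<^sup>2)"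
      unfolding sin_cos_squared_add2 unfolding cos_double_sin by (simp add: algebra_simps)
    also have "(1 - r1) * (1 - r2) * (sin s)\<^sup>2 = r1 * r2"
    proof -
      have "1 - r1 = 4 * a * r1" "1 - r2 = 4 * b * r2" using a b by (simp_all add: r1_def r2_def field_simps)
      then have "(1 - r1) * (1 - r2) * (sin s)\<^sup>2 = (16 * a * b * (sin s)\<^sup>2) * (r1 * r2)" by simp
      then show ?thesis unfolding sin by simp
    qed
    also have "(1 - r1)\<^sup>2 + (1 - r2)\<^sup>2 - 2 * ((1 - r1) * (1 - r2)) + 4 * (r1 * r2) = (r1 + r2)\<^sup>2"
      by (simp add: power2_eq_square algebra_simps)
    finally show ?thesis using r1 r2 by (simp add: power2_eq_iff_nonneg)
  qed
  define d where "d = (c2 - c1) / of_real (r1 + r2)"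
  have d: "cmod d = 1" using r1 r2 unfolding d_def norm_divide norm_of_real dist by simp
  have c21: "c2 = c1 + of_real (r1 + r2) * d" using r1 r2 by (simp add: d_def del: of_real_add)
  \<comment> \<open>For d = -1 the centre c2 would lie outside the unit disc, whereas |c2| = 1 -
    r2.\<close>
  have d_ne: "d \<noteq> - 1"
  proof
    assume "d = - 1"
    then have "c2 = of_real (- 1 - r2)" unfolding c21 by (simp add: c1_def)
    then have "cmod c2 = 1 + r2" using r2 by (simp only: norm_of_real)
    moreover have "cmod c2 = 1 - r2" using r2 unfolding c2_def norm_mult by (simp add: norm_exp_eq_Re del: of_real_diff)
    ultimately show False using r2 by simp
  qed
  define \<sigma> where "\<sigma> = csqrt d"
  have \<sigma>2: "\<sigma>\<^sup>2 = d" by (simp add: \<sigma>_def)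
  have \<sigma>1: "cmod \<sigma> = 1"
  proof -
    have "cmod \<sigma> = 1 \<or> cmod \<sigma> = - 1"
      using d unfolding \<sigma>2[symmetric] by (simp add: norm_power power2_eq_1_iff)
    then show ?thesis using norm_ge_zero[of \<sigma>] by linarith
  qed
  have \<sigma>c: "\<sigma> * cnj \<sigma> = 1" using \<sigma>1 by (simp flip: complex_norm_square)
  \<comment> \<open>Needed for the decay: along real \<zeta> the Gaussian average is centred at a
    multiple of Re \<sigma>, which must move.\<close>
  have Re\<sigma>: "Re \<sigma> \<noteq> 0"
  proof
    assume 0: "Re \<sigma> = 0"
    have "(Im \<sigma>)\<^sup>2 = 1" using \<sigma>1 cmod_power2[of \<sigma>] 0 by simp
    then have "\<sigma>\<^sup>2 = - 1" using 0 by (simp add: complex_eq_iff power2_eq_square)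
    then show False using \<sigma>2 d_ne by simp
  qed
  \<comment> \<open>The point of contact: c1 = q - r1 d and c2 = q + r2 d. With \<zeta> = \<sigma> z
    one has d z^2 = \<zeta>^2, so removing q leaves the exponents r1 (|\<zeta>^2| - Re \<zeta>^2) /
    2 and r2 (|\<zeta>^2| + Re \<zeta>^2) / 2.\<close>
  define q where "q = c1 + of_real r1 * d"
  define H where "H = (\<lambda>\<zeta>. transform \<phi> \<omega> (cnj \<sigma> * \<zeta>) * exp (- q * (cnj \<sigma> * \<zeta>)\<^sup>2 / 2))"
  have dw: "d * (cnj \<sigma> * \<zeta>)\<^sup>2 = \<zeta>\<^sup>2" and nw: "cmod ((cnj \<sigma> * \<zeta>)\<^sup>2) = cmod (\<zeta>\<^sup>2)" for \<zeta>
  proof -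
    have "d * (cnj \<sigma> * \<zeta>)\<^sup>2 = (\<sigma> * cnj \<sigma>)\<^sup>2 * \<zeta>\<^sup>2"
      by (simp only: \<sigma>2[symmetric] power_mult_distrib mult.assoc)
    then show "d * (cnj \<sigma> * \<zeta>)\<^sup>2 = \<zeta>\<^sup>2" unfolding \<sigma>c by simp
    show "cmod ((cnj \<sigma> * \<zeta>)\<^sup>2) = cmod (\<zeta>\<^sup>2)" by (simp add: norm_power norm_mult \<sigma>1)
  qed
  have nH: "cmod (H \<zeta>) = cmod (transform \<phi> \<omega> (cnj \<sigma> * \<zeta>)) * exp (- Re (q * (cnj \<sigma> * \<zeta>)\<^sup>2) / 2)" for \<zeta>
    by (simp add: H_def norm_mult norm_exp_eq_Re field_simps)
  \<comment> \<open>\<open>N1\<close> is kept instead of its bound \<open>D1\<close>: on the real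
    line the exponential is 1 and \<open>N1\<close> supplies the decay.\<close>
  have H1: "cmod (H \<zeta>) \<le> exp (r1 * (Im \<zeta>)\<^sup>2) * N1 (2 * r1 * Re (cnj \<sigma> * \<zeta>))" for \<zeta>
  proof -
    let ?w = "(cnj \<sigma> * \<zeta>)\<^sup>2"
    have "q * ?w = c1 * ?w + of_real r1 * \<zeta>\<^sup>2"
      unfolding q_def by (simp only: distrib_right mult.assoc dw)
    then have "Re (q * ?w) = Re (c1 * ?w) + r1 * Re (\<zeta>\<^sup>2)"
      by (simp only: plus_complex.simps(1)) simp
    then have e: "(r1 * cmod ?w + Re (c1 * ?w)) / 2 + - Re (q * ?w) / 2 = r1 * (Im \<zeta>)\<^sup>2"
      unfolding nw cmod_square_Im by (simp add: field_simps)
    have "cmod (H \<zeta>) \<le> exp ((r1 * cmod ?w + Re (c1 * ?w)) / 2) * N1 (2 * r1 * Re (cnj \<sigma> * \<zeta>)) * exp (- Re (q * ?w) / 2)"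
      unfolding nH by (intro mult_right_mono F1) auto
    also have "\<dots> = exp (r1 * (Im \<zeta>)\<^sup>2) * N1 (2 * r1 * Re (cnj \<sigma> * \<zeta>))"
      unfolding e[symmetric] exp_add by (simp only: mult_ac)
    finally show ?thesis .
  qed
  have H2: "cmod (H \<zeta>) \<le> D2 * exp (r2 * (Re \<zeta>)\<^sup>2)" for \<zeta>
  proof -
    let ?w = "(cnj \<sigma> * \<zeta>)\<^sup>2"
    have "c2 * ?w = q * ?w + of_real r2 * \<zeta>\<^sup>2"
      unfolding q_def c21 by (simp only: distrib_right mult.assoc dw of_real_add) simp
    then have "Re (c2 * ?w) = Re (q * ?w) + r2 * Re (\<zeta>\<^sup>2)"
      by (simp only: plus_complex.simps(1)) simp
    then have e: "(r2 * cmod ?w + Re (c2 * ?w)) / 2 + - Re (q * ?w) / 2 = r2 * (Re \<zeta>)\<^sup>2"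
      unfolding nw cmod_square_Re by (simp add: field_simps)
    have "cmod (H \<zeta>) \<le> exp ((r2 * cmod ?w + Re (c2 * ?w)) / 2) * D2 * exp (- Re (q * ?w) / 2)"
      unfolding nH by (intro mult_right_mono F2) auto
    also have "\<dots> = D2 * exp (r2 * (Re \<zeta>)\<^sup>2)"
      unfolding e[symmetric] exp_add by (simp only: mult_ac)
    finally show ?thesis .
  qed
  have "H (\<sigma> * z) = 0"
  proof (rule entire_eq_0_of_cross_bounds[where H = H and ?C1.0 = D1 and ?K1.0 = r1 and ?C2.0 = D2 and ?K2.0 = r2])
    have "(\<lambda>\<zeta>. transform \<phi> \<omega> (cnj \<sigma> * \<zeta>)) holomorphic_on UNIV"
      using holomorphic_on_compose_gen[OF _ transform_holomorphic[OF \<phi> \<omega>], of "\<lambda>\<zeta>. cnj \<sigma> * \<zeta>" UNIV]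
      by (simp add: o_def holomorphic_on_mult)
    then show "H holomorphic_on UNIV" unfolding H_def by (intro holomorphic_intros) auto
    show "cmod (H \<zeta>) \<le> D1 * exp (r1 * (Im \<zeta>)\<^sup>2)" for \<zeta>
      using H1[of \<zeta>] mult_left_mono[OF D1, of "exp (r1 * (Im \<zeta>)\<^sup>2)"] by (metis exp_ge_zero mult.commute order_trans)
    show "cmod (H \<zeta>) \<le> D2 * exp (r2 * (Re \<zeta>)\<^sup>2)" for \<zeta> by (rule H2)
    show "((\<lambda>r. H (of_real r)) \<longlongrightarrow> 0) at_top"
    proof (rule Lim_null_comparison)
      show "((\<lambda>r. N1 (2 * r1 * Re \<sigma> * r)) \<longlongrightarrow> 0) at_top"
        unfolding N1_def by (rule gaussian_average_tendsto[OF h1 a4 \<omega>]) (use r1 Re\<sigma> in simp)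
      show "eventually (\<lambda>r. cmod (H (of_real r)) \<le> N1 (2 * r1 * Re \<sigma> * r)) at_top"
        using H1[of "of_real _"] by (intro always_eventually allI) (simp add: mult.assoc)
    qed
  qed
  moreover have "cnj \<sigma> * (\<sigma> * z) = z" using \<sigma>c by (simp add: mult.assoc[symmetric] mult.commute)
  ultimately show ?thesis by (simp add: H_def)
qed

section \<open>From the transform back to the function, and conclusion\<close>

text \<open>For z = i |\<xi>| and \<omega> in the direction of \<xi>,
  \<open>coherent \<omega> z\<close> is exp (i \<xi> . x) times a constant, so the transform
  contains the Fourier transform of \<phi> times the density.\<close>

lemma transform_eq_0_imp_AE_0:
  fixes \<phi> :: "real ^ 'n \<Rightarrow> complex"
  assumes \<phi>: "\<phi> \<in> L2 gauss" and zero: "\<And>\<omega> z. norm \<omega> = 1 \<Longrightarrow> transform \<phi> \<omega> z = 0"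
  shows "AE x in gauss. \<phi> x = 0"
proof -
  have [measurable]: "\<phi> \<in> borel_measurable borel" using \<phi> by (simp add: L2_iff)
  have "(\<lambda>x. 1) \<in> L2 (gauss :: (real ^ 'n) measure)"
    by (rule L2_gauss_exp_growth[of _ 1 0]) auto
  from L2_mult_integrable(2)[OF this \<phi>] have "integrable gauss \<phi>" by simp
  then have int: "integrable lborel (\<lambda>x. exp (- (norm x)\<^sup>2 / 2) *\<^sub>R \<phi> x)" by (simp add: integrable_gauss)
  have "AE x in lborel. exp (- (norm x)\<^sup>2 / 2) *\<^sub>R \<phi> x = 0"
  proof (rule fourier_uniqueness[OF int])
    fix \<xi> :: "real ^ 'n"
    \<comment> \<open>For \<xi> = 0 any unit vector serves, as then z = 0.\<close>
    obtain \<omega> :: "real ^ 'n" where \<omega>: "norm \<omega> = 1" "\<xi> = norm \<xi> *\<^sub>R \<omega>"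
    proof (cases "\<xi> = 0")
      case True
      then show ?thesis using that[of "axis undefined 1"] by (simp add: norm_axis_1)
    next
      case False
      then show ?thesis using that[of "\<xi> /\<^sub>R norm \<xi>"] by simp
    qed
    define z where "z = \<i> * of_real (norm \<xi>)"
    have eq: "\<phi> x * exp (\<i> * of_real (\<xi> \<bullet> x)) = exp (z\<^sup>2 / 2) * (\<phi> x * coherent \<omega> z x)" for x
    proof -
      have "\<xi> \<bullet> x = norm \<xi> * (\<omega> \<bullet> x)" by (subst \<omega>(2)) simp
      then have "exp (\<i> * of_real (\<xi> \<bullet> x)) = exp (z\<^sup>2 / 2) * coherent \<omega> z x"
        unfolding coherent_def exp_add[symmetric] by (simp add: z_def mult.assoc)
      then show ?thesis by simp
    qed
    have "(\<integral>x. \<phi> x * exp (\<i> * of_real (\<xi> \<bullet> x)) \<partial>gauss) = 0"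
      unfolding eq integral_mult_right_zero using zero[OF \<omega>(1), of z] by (simp add: transform_def)
    then show "(\<integral>x. exp (- (norm x)\<^sup>2 / 2) *\<^sub>R \<phi> x * exp (\<i> * of_real (\<xi> \<bullet> x)) \<partial>lborel) = 0"
      by (simp add: integral_gauss)
  qed
  then have "AE x in lborel. \<phi> x = 0" by eventually_elim simp
  then show ?thesis unfolding gauss_def by (subst AE_density) auto
qed

lemma weighted_L2_mono:
  assumes \<phi>: "\<phi> \<in> L2 gauss" and le: "a' \<le> a"
    and w: "(\<lambda>x. complex_of_real (exp (a * (norm x)\<^sup>2)) * \<phi> x) \<in> L2 gauss"
  shows "(\<lambda>x. complex_of_real (exp (a' * (norm x)\<^sup>2)) * \<phi> x) \<in> L2 gauss"
proof -
  have [measurable]: "\<phi> \<in> borel_measurable borel" using \<phi> by (simp add: L2_iff)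
  have "integrable gauss (\<lambda>x. (cmod (complex_of_real (exp (a' * (norm x)\<^sup>2)) * \<phi> x))\<^sup>2)"
  proof (rule Bochner_Integration.integrable_bound)
    show "integrable gauss (\<lambda>x. (cmod (complex_of_real (exp (a * (norm x)\<^sup>2)) * \<phi> x))\<^sup>2)"
      using w by (simp add: L2_iff)
    have "(cmod (complex_of_real (exp (a' * (norm x)\<^sup>2)) * \<phi> x))\<^sup>2
        \<le> (cmod (complex_of_real (exp (a * (norm x)\<^sup>2)) * \<phi> x))\<^sup>2" for x
      using le by (intro power_mono) (auto simp: norm_mult intro!: mult_right_mono)
    then show "AE x in gauss. norm ((cmod (complex_of_real (exp (a' * (norm x)\<^sup>2)) * \<phi> x))\<^sup>2)
        \<le> norm ((cmod (complex_of_real (exp (a * (norm x)\<^sup>2)) * \<phi> x))\<^sup>2)" by simp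
  qed simp
  then show ?thesis by (simp add: L2_iff)
qed

theorem theorem1p1:
  fixes L :: "(real ^ 'n) op_graph"
    and U :: "real \<Rightarrow> (real ^ 'n \<Rightarrow> complex) \<Rightarrow> (real ^ 'n \<Rightarrow> complex)"
    and \<phi> :: "real ^ 'n \<Rightarrow> complex"
    and f :: "real ^ 'n \<Rightarrow> real \<Rightarrow> complex"
    and a b s :: real
  assumes "ou_self_adjoint L"
    and "stone_group gauss L U"
    and "\<phi> \<in> L2 gauss"
    and "\<And>x t. f x t = U t \<phi> x"
    and "a > 0" and "b > 0"
    and "L2norm gauss (\<lambda>x. complex_of_real (exp (a * (norm x)\<^sup>2)) * f x 0)
       + L2norm gauss (\<lambda>x. complex_of_real (exp (b * (norm x)\<^sup>2)) * f x s) < \<infinity>"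
    and "a * b * (sin s)\<^sup>2 \<ge> 1 / 16"
  shows "\<forall>t. AE x in gauss. f x t = 0"
proof -
  have uo: "unitary_operator gauss (U t)" for t
    using assms(2) by (simp add: stone_group_def unitary_group_def)
  have UL2: "U t \<phi> \<in> L2 gauss" for t
    using uo[of t] assms(3) by (simp add: unitary_operator_def)
  have [measurable]: "U t \<phi> \<in> borel_measurable borel" for t using UL2[of t] by (simp add: L2_iff)
  \<comment> \<open>\<open>U 0 \<phi>\<close> agrees with \<phi> only almost everywhere, so the
    argument is run with \<open>U 0 \<phi>\<close>, the function that f provides at time 0.\<close>
  have wa: "(\<lambda>x. complex_of_real (exp (a * (norm x)\<^sup>2)) * U 0 \<phi> x) \<in> L2 gauss"
    and wb: "(\<lambda>x. complex_of_real (exp (b * (norm x)\<^sup>2)) * U s \<phi> x) \<in> L2 gauss"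
    using assms(7) by (auto simp: assms(4) L2_def)
  have sin: "sin s \<noteq> 0" using assms(8) by auto
  \<comment> \<open>The weight for which the threshold is attained exactly; the hypothesis says that
    it does not exceed a.\<close>
  define a' where "a' = 1 / (16 * b * (sin s)\<^sup>2)"
  have a': "a' > 0" "a' \<le> a" "16 * a' * b * (sin s)\<^sup>2 = 1"
    using assms(6,8) sin by (auto simp: a'_def field_simps)
  have "transform (U 0 \<phi>) \<omega> z = 0" if "norm \<omega> = 1" for \<omega> z
    by (rule transform_eq_0[OF UL2 UL2 a'(1) \<open>b > 0\<close> weighted_L2_mono[OF UL2 a'(2) wa] wb a'(3) that
          transform_flow[OF assms(1-3) that]])
  then have "AE x in gauss. U 0 \<phi> x = 0" by (rule transform_eq_0_imp_AE_0[OF UL2])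
  \<comment> \<open>Unitarity carries the vanishing from time 0 to all times: every
    \<open>U t \<phi>\<close> has the same norm as \<phi>.\<close>
  then have "(\<integral>x. (cmod (U 0 \<phi> x))\<^sup>2 \<partial>gauss) = (\<integral>x. 0 \<partial>(gauss :: (real ^ 'n) measure))"
    by (intro integral_cong_AE) auto
  then have zero: "(\<integral>x. (cmod (U t \<phi> x))\<^sup>2 \<partial>gauss) = 0" for t
    using unitary_operator_integral_square[OF uo assms(3)] by simp
  have "AE x in gauss. (cmod (U t \<phi> x))\<^sup>2 = 0" for t
    using zero[of t] UL2[of t] by (subst (asm) integral_nonneg_eq_0_iff_AE) (auto simp: L2_iff)
  then show ?thesis by (simp add: assms(4))
qed

end
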